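(* For every positive integer $k\ne2$ and every $m\in\{5,6,7,11\}$ there exists a pair of orthogonal Italian squares of order $km$, neither of which is a Latin square. Moreover, for every positive integer $k\notin\{2,3,6,10\}$ there exists a set of three pairwise orthogonal Italian squares of order $7k$, none of which is a Latin square.
   Context: An alternating sign hypermatrix (ASHM) of order $n$ is an $n\times n\times n$ array $(a_{ijk})$ with entries in $\{0,1,-1\}$ such that the non-zero entries in each row, column and vertical line (i.e. each line obtained by fixing two of the three indices) alternate in sign, beginning and ending with $+1$. An Italian square $L$ of order $n$ is an $n\times n$ array, each cell containing a signed formal sum of a subset of the symbols $\{1,\dots,n\}$, such that each formal sum in ascending order, and each symbol within each row and each column, alternates in sign beginning and ending with $+$. Equivalently it corresponds to an ASHM $(a_{ijk})$, where $a_{ijk}$ is the coefficient of symbol $k$ in cell $(i,j)$. The planes of $L$ are the matrices $L_k=(a_{ijk})_{i,j}$, $k=1,\dots,n$. An Italian square is a Latin square if and only if every cell contains a single symbol (with sign $+$), equivalently all its planes are permutation matrices, equivalently its ASHM has no $-1$ entry. Two Italian squares $A,B$ of order $n$ with planes $(A_i)$, $(B_j)$ are orthogonal if $\langle A_i,B_j\rangle=1$ for all $i,j\in\{1,\dots,n\}$, where $\langle M,N\rangle=\sum_{s,t}M_{st}N_{st}$. A set of Italian squares is pairwise orthogonal (POIS) if any two distinct elements of it are orthogonal. *)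

theory Defs
  imports Main
begin

text \<open>Rows, columns and symbols are indexed by \<open>{1..n}\<close>. A cell, i.e. a signed formal sum of
  symbols, is given by its coefficient function, so that \<open>L i j k\<close> is the coefficient of the
  symbol \<open>k\<close> in the cell \<open>(i, j)\<close> of \<open>L\<close>.\<close>

type_synonym cell = "nat \<Rightarrow> int"
type_synonym square = "nat \<Rightarrow> nat \<Rightarrow> cell"

text \<open>Beginning and ending with \<open>+1\<close> includes that there is at least one non-zero entry.\<close>

definition alternating_line :: "nat \<Rightarrow> (nat \<Rightarrow> int) \<Rightarrow> bool" where
  "alternating_line n f \<longleftrightarrow>
     (\<forall>i\<in>{1..n}. f i \<in> {0, 1, -1}) \<and>
     (let xs = filter (\<lambda>x. x \<noteq> 0) (map f [1..<n+1]) in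
        xs \<noteq> [] \<and> hd xs = 1 \<and> last xs = 1 \<and> successively (\<lambda>x y. y = - x) xs)"

text \<open>The last conjunct normalises the values outside the index range, so that two Italian squares
  of order \<open>n\<close> are equal as HOL functions iff they agree in every cell.\<close>

definition italian_square :: "nat \<Rightarrow> square \<Rightarrow> bool" where
  "italian_square n L \<longleftrightarrow>
     (\<forall>i\<in>{1..n}. \<forall>j\<in>{1..n}. alternating_line n (\<lambda>k. L i j k)) \<and>
     (\<forall>i\<in>{1..n}. \<forall>k\<in>{1..n}. alternating_line n (\<lambda>j. L i j k)) \<and>
     (\<forall>j\<in>{1..n}. \<forall>k\<in>{1..n}. alternating_line n (\<lambda>i. L i j k)) \<and>
     (\<forall>i j k. \<not> (i \<in> {1..n} \<and> j \<in> {1..n} \<and> k \<in> {1..n}) \<longrightarrow> L i j k = 0)"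

definition latin_square :: "nat \<Rightarrow> square \<Rightarrow> bool" where
  "latin_square n L \<longleftrightarrow> italian_square n L \<and>
     (\<forall>i\<in>{1..n}. \<forall>j\<in>{1..n}. \<exists>k\<in>{1..n}. L i j k = 1 \<and> (\<forall>l\<in>{1..n}. l \<noteq> k \<longrightarrow> L i j l = 0))"

definition square_plane :: "square \<Rightarrow> nat \<Rightarrow> nat \<Rightarrow> nat \<Rightarrow> int" where
  "square_plane L k = (\<lambda>i j. L i j k)"

definition matrix_inner :: "nat \<Rightarrow> (nat \<Rightarrow> nat \<Rightarrow> int) \<Rightarrow> (nat \<Rightarrow> nat \<Rightarrow> int) \<Rightarrow> int" where
  "matrix_inner n M N = (\<Sum>s\<in>{1..n}. \<Sum>t\<in>{1..n}. M s t * N s t)"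

definition orthogonal_squares :: "nat \<Rightarrow> square \<Rightarrow> square \<Rightarrow> bool" where
  "orthogonal_squares n A B \<longleftrightarrow>
     (\<forall>i\<in>{1..n}. \<forall>j\<in>{1..n}. matrix_inner n (square_plane A i) (square_plane B j) = 1)"

definition pois :: "nat \<Rightarrow> square set \<Rightarrow> bool" where
  "pois n S \<longleftrightarrow> (\<forall>L\<in>S. italian_square n L) \<and> pairwise (orthogonal_squares n) S"

end

theory Submission
  imports Defs "HOL-Library.Product_Lexorder"
begin

text \<open>All squares are built from a few small ones, which are verified by computation: pairs of
orthogonal Italian squares of orders \<open>5\<close>, \<open>6\<close>, \<open>11\<close> and a triple of order \<open>7\<close>, each square
having a negative entry, and Latin squares over the fields with \<open>4\<close>, \<open>5\<close>, \<open>8\<close> and \<open>9\<close> elements.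

There are two ways to larger orders. The first one is the Kronecker product
(\<open>italian_family_times\<close>), which is compatible with alternation because a line alternates iff its
partial sums lie in \<open>{0, 1}\<close> and its total is \<open>1\<close>. Together with the squares \<open>i + c j\<close>
modulo \<open>k\<close>, which are Latin and orthogonal for \<open>1 \<le> c \<le> t\<close> if the numbers up to \<open>t\<close> are prime to
\<open>k\<close>, it settles odd \<open>k\<close> for pairs and \<open>k\<close> prime to \<open>6\<close> for triples.

For most other \<open>k\<close> the Italian squares do not enter as a factor but as a small part. The second
tool is Wilson's construction of orthogonal Latin squares from a transversal design with two
truncated groups. It yields the order \<open>m g + u1 + u2\<close> from squares of orders \<open>m\<close>, \<open>m + 1\<close>,
\<open>m + 2\<close>, \<open>u1\<close>, \<open>u2\<close> and a design on groups of size \<open>g\<close>. Its output is a gluing of smaller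
squares along a system of blocks, and such a gluing (\<open>italian_family_glue\<close>) makes sense for
Italian squares: every line of the large array lies in a single block, up to zeros. So Italian
squares with negative entries can be inserted into a hole of order \<open>u1\<close> or into the blocks of
order \<open>m\<close> (\<open>wilson_construction\<close>).

The point of the choice of parameters is that \<open>g\<close> can always be taken prime to \<open>6\<close> or \<open>30\<close>, so
that the design is the cyclic one. For pairs \<open>m = 3\<close>, and an Italian hole of order \<open>5\<close> or \<open>7\<close>
reaches all even orders from \<open>40\<close> on (\<open>even_order_decomposition\<close>). For triples \<open>m = 7\<close>, with the triple of
order \<open>7\<close> in the blocks, and orders \<open>7 k\<close> are reached for all but a few small \<open>k\<close>
(\<open>triple_order_decomposition\<close>). Of the small orders left over, those in the theorem are products.\<close>

section \<open>Alternating lines\<close>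

text \<open>A line of entries in \<open>{0, 1, -1}\<close> alternates in sign, beginning and ending with \<open>+1\<close>, iff its
partial sums stay in \<open>{0, 1}\<close> and its total is \<open>1\<close>. In this form the condition survives products
and the insertion of zeros by a computation with sums. The index set is an arbitrary linear
order because the constructions below produce squares whose rows, columns and symbols are pairs,
ordered lexicographically.\<close>

definition alternating :: "'a::linorder set \<Rightarrow> ('a \<Rightarrow> int) \<Rightarrow> bool" where
  "alternating A f \<longleftrightarrow> sum f A = 1 \<and> (\<forall>a\<in>A. sum f {x\<in>A. x \<le> a} \<in> {0, 1})"

lemma alternating_cong:
  assumes "\<And>x. x \<in> A \<Longrightarrow> f x = g x"
  shows "alternating A f \<longleftrightarrow> alternating A g"
proof -
  have "sum f {x\<in>A. Q x} = sum g {x\<in>A. Q x}" for Q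
    using assms by (intro sum.cong) auto
  from this this[of "\<lambda>_. True"] show ?thesis by (simp add: alternating_def)
qed

lemma alternating_down_sum:
  assumes "finite A" "alternating A f" "D \<subseteq> A" "\<And>x y. x \<in> A \<Longrightarrow> y \<in> D \<Longrightarrow> x \<le> y \<Longrightarrow> x \<in> D"
  shows "sum f D \<in> {0, 1}"
proof (cases "D = {}")
  case False
  have "finite D" using assms(3,1) by (rule finite_subset)
  then have max: "Max D \<in> D" "\<And>x. x \<in> D \<Longrightarrow> x \<le> Max D" using False by auto
  have "x \<in> D \<longleftrightarrow> x \<in> A \<and> x \<le> Max D" for x
    using assms(4)[OF _ max(1), of x] max(2)[of x] assms(3) by blast
  then have "D = {x\<in>A. x \<le> Max D}" by blast
  moreover have "Max D \<in> A" using assms(3) max(1) by auto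
  ultimately show ?thesis using assms(2) unfolding alternating_def by metis
qed simp

lemma alternating_extend:
  assumes "finite A" "strict_mono_on B h" "h ` B \<subseteq> A"
    and zero: "\<And>x. x \<in> A \<Longrightarrow> x \<notin> h ` B \<Longrightarrow> f x = 0"
    and alt: "alternating B (\<lambda>b. f (h b))"
  shows "alternating A f"
proof -
  have inj: "inj_on h B" using assms(2) by (rule strict_mono_on_imp_inj_on)
  have finB: "finite B" using assms(1,3) inj by (metis finite_imageD finite_subset)
  have red: "sum f {x\<in>A. Q x} = sum (\<lambda>b. f (h b)) {b\<in>B. Q (h b)}" for Q
  proof -
    have "sum f {x\<in>A. Q x} = sum f (h ` {b\<in>B. Q (h b)})"
      using assms(1,3) zero by (intro sum.mono_neutral_right) auto
    also have "\<dots> = sum (\<lambda>b. f (h b)) {b\<in>B. Q (h b)}"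
      using inj by (subst sum.reindex) (auto intro: inj_on_subset)
    finally show ?thesis .
  qed
  have mono: "h x \<le> h y" if "x \<in> B" "y \<in> B" "x \<le> y" for x y
    using assms(2) that by (rule strict_mono_on_leD)
  have "sum f {x\<in>A. x \<le> a} \<in> {0, 1}" for a
    unfolding red using finB alt
    by (rule alternating_down_sum) (use mono in \<open>auto intro: order_trans\<close>)
  moreover have "sum f A = 1"
    using red[of "\<lambda>_. True"] alt by (simp add: alternating_def)
  ultimately show ?thesis by (auto simp: alternating_def)
qed

text \<open>Up to \<open>(a, b)\<close> in lexicographic order, all columns before \<open>a\<close> are complete and contribute the
partial sum of \<open>f\<close> before \<open>a\<close>; the column \<open>a\<close> contributes \<open>f a\<close> times a partial sum of \<open>g\<close>,
which is \<open>0\<close> or \<open>1\<close>. So every partial sum of the product is one of two consecutive partial sums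
of \<open>f\<close>.\<close>

lemma alternating_times:
  assumes "finite A" "finite B" "alternating A f" "alternating B g"
  shows "alternating (A \<times> B) (\<lambda>(a, b). f a * g b)"
proof -
  have prod: "sum (\<lambda>(a, b). f a * g b) (X \<times> Y) = sum f X * sum g Y" for X Y
    by (simp add: sum.cartesian_product[symmetric] sum_product)
  have "sum (\<lambda>(a, b). f a * g b) {x\<in>A \<times> B. x \<le> (a, b)} \<in> {0, 1}"
    if "a \<in> A" "b \<in> B" for a b
  proof -
    have split: "{x\<in>A \<times> B. x \<le> (a, b)} = {x\<in>A. x < a} \<times> B \<union> {a} \<times> {y\<in>B. y \<le> b}"
      using that by (auto simp: less_eq_prod_def)
    have "sum (\<lambda>(a, b). f a * g b) {x\<in>A \<times> B. x \<le> (a, b)} =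
        sum (\<lambda>(a, b). f a * g b) ({x\<in>A. x < a} \<times> B) +
        sum (\<lambda>(a, b). f a * g b) ({a} \<times> {y\<in>B. y \<le> b})"
      unfolding split using assms by (intro sum.union_disjoint) auto
    also have "\<dots> = sum f {x\<in>A. x < a} * sum g B + f a * sum g {y\<in>B. y \<le> b}"
      by (simp add: prod)
    finally have eq: "sum (\<lambda>(a, b). f a * g b) {x\<in>A \<times> B. x \<le> (a, b)} =
        sum f {x\<in>A. x < a} + f a * sum g {y\<in>B. y \<le> b}"
      using assms(4) by (simp add: alternating_def)
    have "{x\<in>A. x \<le> a} = insert a {x\<in>A. x < a}" using that by auto
    then have "sum f {x\<in>A. x < a} + f a = sum f {x\<in>A. x \<le> a}"
      using assms(1) by simp
    also have "\<dots> \<in> {0, 1}" using assms(3) that by (simp add: alternating_def)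
    finally have "sum f {x\<in>A. x < a} + f a \<in> {0, 1}" .
    moreover have "sum f {x\<in>A. x < a} \<in> {0, 1}"
      using assms(1,3) by (rule alternating_down_sum) auto
    moreover have "sum g {y\<in>B. y \<le> b} \<in> {0, 1}"
      using assms(4) that by (simp add: alternating_def)
    ultimately show ?thesis unfolding eq by auto
  qed
  then show ?thesis using assms(3,4) prod[of A B] unfolding alternating_def by auto
qed

section \<open>Families of pairwise orthogonal Italian squares\<close>

text \<open>\<open>L c i j k\<close> is the coefficient of the symbol \<open>k\<close> in the cell \<open>(i, j)\<close> of the \<open>c\<close>-th square. The
squares are numbered by \<open>c < t\<close>; that different numbers belong to different squares is shown
only at the end (\<open>orthogonal_imp_distinct\<close>).\<close>

definition italian_family :: "nat \<Rightarrow> 'a::linorder set \<Rightarrow> (nat \<Rightarrow> 'a \<Rightarrow> 'a \<Rightarrow> 'a \<Rightarrow> int) \<Rightarrow> bool" where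
  "italian_family t A L \<longleftrightarrow>
     (\<forall>c<t. \<forall>x\<in>A. \<forall>y\<in>A. alternating A (\<lambda>z. L c x y z) \<and>
        alternating A (\<lambda>z. L c x z y) \<and> alternating A (\<lambda>z. L c z x y)) \<and>
     (\<forall>c<t. \<forall>d<t. c \<noteq> d \<longrightarrow> (\<forall>k\<in>A. \<forall>l\<in>A. (\<Sum>i\<in>A. \<Sum>j\<in>A. L c i j k * L d i j l) = 1))"

lemma italian_family_reindex:
  assumes "finite A" "finite B" "strict_mono_on B h" "h ` B = A" "italian_family t A L"
  shows "italian_family t B (\<lambda>c i j k. L c (h i) (h j) (h k))"
proof -
  have inj: "inj_on h B" using assms(3) by (rule strict_mono_on_imp_inj_on)
  have pull: "alternating B (\<lambda>b. f (h b))" if "alternating A f" for f :: "'a \<Rightarrow> int"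
  proof (rule alternating_extend[where h = "inv_into B h" and B = A])
    show "strict_mono_on A (inv_into B h)"
    proof (rule strict_mono_onI)
      fix r s assume "r \<in> A" "s \<in> A" "r < s"
      then obtain r' s' where rs: "r = h r'" "s = h s'" "r' \<in> B" "s' \<in> B"
        using assms(4) by blast
      have "r' < s'"
      proof (rule ccontr)
        assume "\<not> r' < s'"
        then have "h s' \<le> h r'" using rs by (intro strict_mono_on_leD[OF assms(3)]) auto
        with \<open>r < s\<close> show False by (simp add: rs)
      qed
      then show "inv_into B h r < inv_into B h s" using rs inj by simp
    qed
    show "inv_into B h ` A \<subseteq> B" using assms(4) by (auto intro: inv_into_into)
    show "f (h x) = 0" if "x \<in> B" "x \<notin> inv_into B h ` A" for x
      using that assms(4) inj by (metis image_eqI inv_into_f_f)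
    have "alternating A (\<lambda>b. f (h (inv_into B h b))) = alternating A f"
      using assms(4) by (intro alternating_cong) (simp add: f_inv_into_f)
    with that show "alternating A (\<lambda>b. f (h (inv_into B h b)))" by simp
  qed fact
  have "(\<Sum>i\<in>B. \<Sum>j\<in>B. L c (h i) (h j) (h k) * L d (h i) (h j) (h l)) =
      (\<Sum>i\<in>A. \<Sum>j\<in>A. L c i j (h k) * L d i j (h l))" for c d k l
    unfolding assms(4)[symmetric] using inj by (simp add: sum.reindex)
  moreover have h: "h b \<in> A" if "b \<in> B" for b using that assms(4) by blast
  moreover have "alternating B (\<lambda>z. L c (h x) (h y) (h z)) \<and>
      alternating B (\<lambda>z. L c (h x) (h z) (h y)) \<and> alternating B (\<lambda>z. L c (h z) (h x) (h y))"
    if "c < t" "x \<in> B" "y \<in> B" for c x y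
    using that h assms(5) pull[of "\<lambda>z. L c (h x) (h y) z"] pull[of "\<lambda>z. L c (h x) z (h y)"]
      pull[of "\<lambda>z. L c z (h x) (h y)"] unfolding italian_family_def by simp
  ultimately show ?thesis
    using assms(5) unfolding italian_family_def by simp
qed

text \<open>The Kronecker product of two pairwise orthogonal families. Lines multiply, and the inner product
of two planes is the product of the inner products of the factors.\<close>

lemma italian_family_times:
  assumes "finite A" "finite B" "italian_family t A L" "italian_family t B M"
  shows "italian_family t (A \<times> B) (\<lambda>c x y z. L c (fst x) (fst y) (fst z) * M c (snd x) (snd y) (snd z))"
proof -
  have alt: "alternating (A \<times> B) (\<lambda>z. f (fst z) * g (snd z))"
    if "alternating A f" "alternating B g" for f g
    using alternating_times[OF assms(1,2) that] by (simp add: case_prod_beta')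
  have sum: "(\<Sum>x\<in>A \<times> B. \<Sum>y\<in>A \<times> B. f (fst x) (fst y) * g (snd x) (snd y)) =
      (\<Sum>i\<in>A. \<Sum>j\<in>A. f i j) * (\<Sum>i\<in>B. \<Sum>j\<in>B. g i j)" for f g :: "_ \<Rightarrow> _ \<Rightarrow> int"
  proof -
    have pairs: "(\<Sum>x\<in>A \<times> B. h (fst x) (snd x)) = (\<Sum>i\<in>A. \<Sum>j\<in>B. h i j)"
      for h :: "_ \<Rightarrow> _ \<Rightarrow> int"
      by (simp add: sum.cartesian_product case_prod_beta')
    have "(\<Sum>y\<in>A \<times> B. f i (fst y) * g j (snd y)) = (\<Sum>k\<in>A. f i k) * (\<Sum>l\<in>B. g j l)" for i j
      using pairs[of "\<lambda>k l. f i k * g j l"] by (simp add: sum_product)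
    then show ?thesis
      using pairs[of "\<lambda>i j. (\<Sum>k\<in>A. f i k) * (\<Sum>l\<in>B. g j l)"] by (simp add: sum_product)
  qed
  have eq: "L c (fst x) (fst y) (fst z) * M c (snd x) (snd y) (snd z) *
      (L d (fst x) (fst y) (fst w) * M d (snd x) (snd y) (snd w)) =
      (L c (fst x) (fst y) (fst z) * L d (fst x) (fst y) (fst w)) *
      (M c (snd x) (snd y) (snd z) * M d (snd x) (snd y) (snd w))" for c d x y z w
    by simp
  show ?thesis
    unfolding italian_family_def eq
  proof (intro conjI allI impI ballI)
    fix c d z w assume "c < t" "d < t" "c \<noteq> d" "z \<in> A \<times> B" "w \<in> A \<times> B"
    then show "(\<Sum>x\<in>A \<times> B. \<Sum>y\<in>A \<times> B. (L c (fst x) (fst y) (fst z) * L d (fst x) (fst y) (fst w)) *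
      (M c (snd x) (snd y) (snd z) * M d (snd x) (snd y) (snd w))) = 1"
      using assms(3,4) by (subst sum) (auto simp: italian_family_def)
  qed (use assms(3,4) in \<open>auto intro!: alt simp: italian_family_def\<close>)
qed

definition italian_set_exists :: "nat \<Rightarrow> nat \<Rightarrow> bool" where
  "italian_set_exists t n \<longleftrightarrow> (\<exists>L. italian_family t {..<n} L)"

definition non_latin_set_exists :: "nat \<Rightarrow> nat \<Rightarrow> bool" where
  "non_latin_set_exists t n \<longleftrightarrow>
     (\<exists>L. italian_family t {..<n} L \<and> (\<forall>c<t. \<exists>x<n. \<exists>y<n. \<exists>z<n. L c x y z < 0))"

lemma ex_enumeration:
  fixes A :: "'a::linorder set"
  assumes "finite A"
  obtains h where "strict_mono_on {..<card A} h" "h ` {..<card A} = A"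
proof
  show "strict_mono_on {..<card A} ((!) (sorted_list_of_set A))"
    by (rule strict_mono_onI) (simp add: sorted_wrt_nth_less[OF strict_sorted_list_of_set])
  show "(!) (sorted_list_of_set A) ` {..<card A} = A"
    using assms nth_image[of "card A" "sorted_list_of_set A"] by (simp add: lessThan_atLeast0)
qed

lemma italian_set_existsI:
  assumes "finite A" "italian_family t A L"
  shows "italian_set_exists t (card A)"
proof -
  obtain h where h: "strict_mono_on {..<card A} h" "h ` {..<card A} = A"
    using ex_enumeration[OF assms(1)] .
  have "italian_family t {..<card A} (\<lambda>c i j k. L c (h i) (h j) (h k))"
    by (rule italian_family_reindex[OF assms(1) _ h assms(2)]) simp
  then show ?thesis unfolding italian_set_exists_def by (rule exI[of _ "\<lambda>c i j k. L c (h i) (h j) (h k)"])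
qed

lemma non_latin_set_existsI:
  assumes "finite A" "italian_family t A L"
    and neg: "\<And>c. c < t \<Longrightarrow> \<exists>x\<in>A. \<exists>y\<in>A. \<exists>z\<in>A. L c x y z < 0"
  shows "non_latin_set_exists t (card A)"
proof -
  obtain h where h: "strict_mono_on {..<card A} h" "h ` {..<card A} = A"
    using ex_enumeration[OF assms(1)] .
  have "\<exists>x<card A. \<exists>y<card A. \<exists>z<card A. L c (h x) (h y) (h z) < 0" if c: "c < t" for c
  proof -
    obtain x y z where "x \<in> A" "y \<in> A" "z \<in> A" and less: "L c x y z < 0"
      using neg[OF c] by blast
    then obtain i j k where "i < card A" "j < card A" "k < card A" "x = h i" "y = h j" "z = h k"
      unfolding set_eq_iff[THEN iffD1, OF h(2)[symmetric], rule_format] by auto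
    with less show ?thesis by blast
  qed
  moreover have "italian_family t {..<card A} (\<lambda>c i j k. L c (h i) (h j) (h k))"
    by (rule italian_family_reindex[OF assms(1) _ h assms(2)]) simp
  ultimately show ?thesis
    unfolding non_latin_set_exists_def by (intro exI[of _ "\<lambda>c i j k. L c (h i) (h j) (h k)"]) simp
qed

lemma non_latin_imp_italian: "non_latin_set_exists t n \<Longrightarrow> italian_set_exists t n"
  unfolding non_latin_set_exists_def italian_set_exists_def by blast

lemma italian_family_mono: "s \<le> t \<Longrightarrow> italian_family t A L \<Longrightarrow> italian_family s A L"
  unfolding italian_family_def by simp

lemma italian_set_exists_mono: "s \<le> t \<Longrightarrow> italian_set_exists t n \<Longrightarrow> italian_set_exists s n"
  unfolding italian_set_exists_def using italian_family_mono by blast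

lemma non_latin_set_exists_mono:
  assumes "s \<le> t" "non_latin_set_exists t n"
  shows "non_latin_set_exists s n"
proof -
  obtain L where "italian_family t {..<n} L" "\<forall>c<t. \<exists>x<n. \<exists>y<n. \<exists>z<n. L c x y z < 0"
    using assms(2) unfolding non_latin_set_exists_def by blast
  then have "italian_family s {..<n} L \<and> (\<forall>c<s. \<exists>x<n. \<exists>y<n. \<exists>z<n. L c x y z < 0)"
    using assms(1) italian_family_mono[OF assms(1)] by simp
  then show ?thesis unfolding non_latin_set_exists_def by (rule exI[of _ L])
qed

lemma italian_set_exists_times:
  assumes "italian_set_exists t m" "italian_set_exists t n"
  shows "italian_set_exists t (m * n)"
proof -
  obtain L M where "italian_family t {..<m} L" "italian_family t {..<n} M"
    using assms unfolding italian_set_exists_def by blast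
  from italian_set_existsI[OF _ italian_family_times[OF _ _ this]] show ?thesis
    by (simp add: card_cartesian_product)
qed

text \<open>A negative entry of the first factor meets a positive entry of the second, which exists because
the lines sum to \<open>1\<close>.\<close>

lemma non_latin_set_exists_times:
  assumes "non_latin_set_exists t m" "italian_set_exists t n" "0 < n"
  shows "non_latin_set_exists t (m * n)"
proof -
  obtain L M where L: "italian_family t {..<m} L" "\<And>c. c < t \<Longrightarrow> \<exists>x<m. \<exists>y<m. \<exists>z<m. L c x y z < 0"
    and M: "italian_family t {..<n} M"
    using assms(1,2) unfolding italian_set_exists_def non_latin_set_exists_def by blast
  let ?T = "\<lambda>c x y z. L c (fst x) (fst y) (fst z) * M c (snd x) (snd y) (snd z)"
  have "non_latin_set_exists t (card ({..<m} \<times> {..<n}))"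
  proof (rule non_latin_set_existsI)
    show "italian_family t ({..<m} \<times> {..<n}) ?T" using L M by (intro italian_family_times) auto
    fix c assume c: "c < t"
    then obtain x y z where xyz: "x < m" "y < m" "z < m" "L c x y z < 0" using L(2) by blast
    have "(\<Sum>k<n. M c 0 0 k) = 1"
      using M c assms(3) by (auto simp: italian_family_def alternating_def)
    then obtain k where k: "k < n" "M c 0 0 k > 0"
      using sum_nonpos[of "{..<n}" "M c 0 0"] by force
    with xyz assms(3) have "(x, 0) \<in> {..<m} \<times> {..<n}" "(y, 0) \<in> {..<m} \<times> {..<n}" "(z, k) \<in> {..<m} \<times> {..<n}"
      "?T c (x, 0) (y, 0) (z, k) < 0" by (auto simp: mult_less_0_iff)
    then show "\<exists>x\<in>{..<m} \<times> {..<n}. \<exists>y\<in>{..<m} \<times> {..<n}. \<exists>z\<in>{..<m} \<times> {..<n}. ?T c x y z < 0" by blast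
  qed simp
  then show ?thesis by (simp add: card_cartesian_product)
qed

lemma italian_family_singleton: "italian_family t {a} (\<lambda>_ _ _ _. 1)"
  by (simp add: italian_family_def alternating_def Collect_conv_if)

lemma italian_set_exists_0: "italian_set_exists t 0"
  by (simp add: italian_set_exists_def italian_family_def)

section \<open>From families to Italian squares\<close>

text \<open>Reading the line from left to right, the last non-zero entry is \<open>1\<close> or \<open>-1\<close> according to whether
the current partial sum is \<open>1\<close> or \<open>0\<close>, and this forces the sign of the next one.\<close>

lemma alternating_imp_line:
  assumes "alternating {1..n} f"
  shows "alternating_line n f"
proof -
  define S where "S m = sum f {1..m}" for m
  have S: "S m \<in> {0, 1}" if "m \<le> n" for m
  proof (cases "m = 0")
    case False
    then have "{x \<in> {1..n}. x \<le> m} = {1..m}" using that by auto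
    moreover have "m \<in> {1..n}" using that False by simp
    ultimately show ?thesis using assms unfolding alternating_def S_def by metis
  qed (simp add: S_def)
  have step: "S (Suc m) = S m + f (Suc m)" for m by (simp add: S_def)
  have entry: "f i \<in> {0, 1, -1}" if "i \<in> {1..n}" for i
  proof -
    have "Suc (i - 1) = i" "i \<le> n" "i - 1 \<le> n" using that by auto
    then show ?thesis using step[of "i - 1"] S[of i] S[of "i - 1"] by auto
  qed
  define xs where "xs m = filter (\<lambda>x. x \<noteq> 0) (map f [1..<m + 1])" for m
  have xs_step: "xs (Suc m) = xs m @ (if f (Suc m) = 0 then [] else [f (Suc m)])" for m
    by (simp add: xs_def)
  have "successively (\<lambda>x y. y = - x) (xs m) \<and> (xs m = [] \<longrightarrow> S m = 0) \<and>
      (xs m \<noteq> [] \<longrightarrow> hd (xs m) = 1 \<and> last (xs m) = (if S m = 1 then 1 else -1))" if "m \<le> n" for m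
    using that
  proof (induction m)
    case (Suc m)
    then show ?case
      using S[of m] S[of "Suc m"] step[of m]
      by (cases "xs m = []") (auto simp: xs_step successively_append_iff)
  qed (simp add: xs_def S_def)
  from this[of n] have "xs n \<noteq> [] \<and> hd (xs n) = 1 \<and> last (xs n) = 1 \<and> successively (\<lambda>x y. y = - x) (xs n)"
    using assms by (auto simp: alternating_def S_def)
  then show ?thesis using entry unfolding alternating_line_def xs_def by (simp add: Let_def)
qed

text \<open>The coefficients of a Latin square are \<open>0\<close> and \<open>1\<close>, so a negative entry excludes it. Families
live on \<open>{..<n}\<close>, hence the shift of the indices by one.\<close>

lemma non_latin_squares:
  assumes "non_latin_set_exists t n"
  shows "\<exists>L. (\<forall>c<t. italian_square n (L c) \<and> \<not> latin_square n (L c)) \<and>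
     (\<forall>c<t. \<forall>d<t. c \<noteq> d \<longrightarrow> orthogonal_squares n (L c) (L d))"
proof -
  obtain K where K: "italian_family t {..<n} K"
    and neg: "\<And>c. c < t \<Longrightarrow> \<exists>x<n. \<exists>y<n. \<exists>z<n. K c x y z < 0"
    using assms unfolding non_latin_set_exists_def by blast
  define L' where "L' c i j k = K c (i - 1) (j - 1) (k - 1)" for c i j k
  have L': "italian_family t {1..n} L'"
    unfolding L'_def
  proof (rule italian_family_reindex[OF _ _ _ _ K])
    show "(\<lambda>i. i - 1) ` {1..n} = {..<n}"
      by (auto simp: image_iff intro!: bexI[of _ "Suc _"])
  qed (auto simp: strict_mono_on_def)
  define L where "L c i j k = (if i \<in> {1..n} \<and> j \<in> {1..n} \<and> k \<in> {1..n} then L' c i j k else 0)" for c i j k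
  have L_eq: "L c i j k = L' c i j k" if "i \<in> {1..n}" "j \<in> {1..n}" "k \<in> {1..n}" for c i j k
    using that by (simp add: L_def)
  have sq: "italian_square n (L c)" if c: "c < t" for c
    unfolding italian_square_def
  proof (intro conjI ballI allI impI)
    fix x y assume xy: "x \<in> {1..n}" "y \<in> {1..n}"
    have lines: "alternating {1..n} (\<lambda>z. L' c x y z)" "alternating {1..n} (\<lambda>z. L' c x z y)"
      "alternating {1..n} (\<lambda>z. L' c z x y)"
      using L' c xy unfolding italian_family_def by auto
    show "alternating_line n (\<lambda>k. L c x y k)"
      using lines(1) xy alternating_cong[of "{1..n}" "\<lambda>z. L c x y z" "\<lambda>z. L' c x y z"]
      by (intro alternating_imp_line) (simp add: L_eq)
    show "alternating_line n (\<lambda>j. L c x j y)"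
      using lines(2) xy alternating_cong[of "{1..n}" "\<lambda>z. L c x z y" "\<lambda>z. L' c x z y"]
      by (intro alternating_imp_line) (simp add: L_eq)
    show "alternating_line n (\<lambda>i. L c i x y)"
      using lines(3) xy alternating_cong[of "{1..n}" "\<lambda>z. L c z x y" "\<lambda>z. L' c z x y"]
      by (intro alternating_imp_line) (simp add: L_eq)
  qed (auto simp: L_def)
  have "\<not> latin_square n (L c)" if c: "c < t" for c
  proof
    assume lat: "latin_square n (L c)"
    obtain x y z where xyz: "x < n" "y < n" "z < n" "K c x y z < 0" using neg[OF c] by blast
    then have less: "L c (Suc x) (Suc y) (Suc z) < 0" by (simp add: L_def L'_def)
    have "Suc x \<in> {1..n}" "Suc y \<in> {1..n}" using xyz by auto
    then obtain k where "L c (Suc x) (Suc y) k = 1" "\<forall>l\<in>{1..n}. l \<noteq> k \<longrightarrow> L c (Suc x) (Suc y) l = 0"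
      using lat unfolding latin_square_def by blast
    with less xyz show False by (cases "Suc z = k") auto
  qed
  moreover have "orthogonal_squares n (L c) (L d)" if "c < t" "d < t" "c \<noteq> d" for c d
    using L' that unfolding orthogonal_squares_def matrix_inner_def square_plane_def italian_family_def
    by (simp add: L_eq)
  ultimately show ?thesis using sq by (intro exI[of _ L]) simp
qed

text \<open>A plane that is orthogonal to itself has a single non-zero entry, but each of its \<open>n\<close> rows
contains one.\<close>

lemma orthogonal_imp_distinct:
  assumes "italian_square n A" "orthogonal_squares n A B" "1 < n"
  shows "A \<noteq> B"
proof
  assume [simp]: "A = B"
  have line: "alternating_line n (\<lambda>j. A i j 1)" if "i \<in> {1..n}" for i
    using assms(1,3) that unfolding italian_square_def by simp
  have "1 \<le> (\<Sum>j\<in>{1..n}. A i j 1 * A i j 1)" if i: "i \<in> {1..n}" for i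
  proof -
    have "filter (\<lambda>x. x \<noteq> 0) (map (\<lambda>j. A i j 1) [1..<n + 1]) \<noteq> []"
      using line[OF i] unfolding alternating_line_def Let_def by simp
    then obtain j where j: "j \<in> {1..n}" "A i j 1 \<noteq> 0" 
      by (auto simp: filter_empty_conv less_Suc_eq_le simp del: upt_Suc)
    then have "A i j 1 > 0 \<or> A i j 1 < 0" by linarith
    then have "0 < A i j 1 * A i j 1" by (auto simp: zero_less_mult_iff)
    also have "A i j 1 * A i j 1 \<le> (\<Sum>j\<in>{1..n}. A i j 1 * A i j 1)"
      using j(1) by (intro member_le_sum) auto
    finally show ?thesis by simp
  qed
  then have "(\<Sum>i\<in>{1..n}. 1) \<le> (\<Sum>i\<in>{1..n}. \<Sum>j\<in>{1..n}. A i j 1 * A i j 1)"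
    by (rule sum_mono)
  also have "\<dots> = 1"
    using assms(2,3) unfolding orthogonal_squares_def matrix_inner_def square_plane_def by simp
  finally show False using assms(3) by simp
qed

section \<open>Gluing orthogonal families\<close>

text \<open>Think of rows, columns and the symbols of the \<open>t\<close> squares as \<open>t + 2\<close> copies of \<open>A\<close>, numbered
\<open>0\<close>, \<open>1\<close>, and \<open>c + 2\<close> for the symbols of the \<open>c\<close>-th square. A part \<open>p\<close> occupies in copy \<open>q\<close> the
image of \<open>D p\<close> under the increasing map \<open>\<phi> p q\<close>. The assumption is that any two points from
different copies lie in exactly one common part, as for the blocks of a transversal design. Then
orthogonal families on the parts glue to an orthogonal family on \<open>A\<close>: two coordinates of a line
determine a part, outside which the line vanishes, and two symbols from different squares also
determine a part, to which the sum for the inner product of their planes is confined.\<close>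

lemma italian_family_glue:
  fixes A :: "'a::linorder set" and D :: "'p \<Rightarrow> 'b::linorder set"
  assumes fin: "finite A"
    and fam: "\<And>p. p \<in> P \<Longrightarrow> italian_family t (D p) (F p)"
    and mono: "\<And>p q. p \<in> P \<Longrightarrow> q < t + 2 \<Longrightarrow> strict_mono_on (D p) (\<phi> p q)"
    and into: "\<And>p q. p \<in> P \<Longrightarrow> q < t + 2 \<Longrightarrow> \<phi> p q ` D p \<subseteq> A"
    and cover: "\<And>q q' r s. q < t + 2 \<Longrightarrow> q' < t + 2 \<Longrightarrow> q \<noteq> q' \<Longrightarrow> r \<in> A \<Longrightarrow> s \<in> A \<Longrightarrow>
        \<exists>p\<in>P. r \<in> \<phi> p q ` D p \<and> s \<in> \<phi> p q' ` D p"
    and unique: "\<And>q q' p p' r s. q < t + 2 \<Longrightarrow> q' < t + 2 \<Longrightarrow> q \<noteq> q' \<Longrightarrow> p \<in> P \<Longrightarrow> p' \<in> P \<Longrightarrow>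
        r \<in> \<phi> p q ` D p \<Longrightarrow> s \<in> \<phi> p q' ` D p \<Longrightarrow>
        r \<in> \<phi> p' q ` D p' \<Longrightarrow> s \<in> \<phi> p' q' ` D p' \<Longrightarrow> p = p'"
  obtains T where "italian_family t A T"
    and "\<And>c p x y z. c < t \<Longrightarrow> p \<in> P \<Longrightarrow> x \<in> D p \<Longrightarrow> y \<in> D p \<Longrightarrow> z \<in> D p \<Longrightarrow>
        T c (\<phi> p 0 x) (\<phi> p 1 y) (\<phi> p (c + 2) z) = F p c x y z"
proof -
  \<comment> \<open>\<open>W c r s k w\<close>: the entry \<open>(r, s, k)\<close> of square \<open>c\<close> comes from part and local entry \<open>w\<close>.\<close>
  define W where "W c r s k w \<longleftrightarrow> (case w of (p, x, y, z) \<Rightarrow> p \<in> P \<and> x \<in> D p \<and> y \<in> D p \<and> z \<in> D p \<and>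
      \<phi> p 0 x = r \<and> \<phi> p 1 y = s \<and> \<phi> p (c + 2) z = k)" for c r s k w
  define T where "T c r s k = (if Ex (W c r s k) then case SOME w. W c r s k w of (p, x, y, z) \<Rightarrow> F p c x y z else 0)"
    for c r s k
  have inj: "inj_on (\<phi> p q) (D p)" if "p \<in> P" "q < t + 2" for p q
    using mono[OF that] by (rule strict_mono_on_imp_inj_on)
  have val: "T c (\<phi> p 0 x) (\<phi> p 1 y) (\<phi> p (c + 2) z) = F p c x y z"
    if cpxyz: "c < t" "p \<in> P" "x \<in> D p" "y \<in> D p" "z \<in> D p" for c p x y z
  proof -
    have W: "W c (\<phi> p 0 x) (\<phi> p 1 y) (\<phi> p (c + 2) z) (p, x, y, z)"
      using cpxyz by (simp add: W_def)
    have "w = (p, x, y, z)" if w: "W c (\<phi> p 0 x) (\<phi> p 1 y) (\<phi> p (c + 2) z) w" for w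
    proof -
      obtain p' x' y' z' where [simp]: "w = (p', x', y', z')" by (cases w)
      have "p' = p"
      proof (rule unique[of 0 1 p' p "\<phi> p 0 x" "\<phi> p 1 y"])
        show "\<phi> p 0 x \<in> \<phi> p' 0 ` D p'" "\<phi> p 1 y \<in> \<phi> p' 1 ` D p'"
          using w unfolding W_def by (auto intro: rev_image_eqI)
      qed (use w W in \<open>auto simp: W_def\<close>)
      moreover from this have "x' = x" "y' = y" "z' = z"
        using w cpxyz inj_onD[OF inj[OF \<open>p \<in> P\<close>, of 0], of x' x]
          inj_onD[OF inj[OF \<open>p \<in> P\<close>, of 1], of y' y]
          inj_onD[OF inj[OF \<open>p \<in> P\<close>, of "c + 2"], of z' z]
        unfolding W_def by auto
      ultimately show ?thesis by simp
    qed
    then have "(SOME w. W c (\<phi> p 0 x) (\<phi> p 1 y) (\<phi> p (c + 2) z) w) = (p, x, y, z)"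
      using W by blast
    then show ?thesis using W by (auto simp: T_def)
  qed
  have supp: "\<exists>p\<in>P. r \<in> \<phi> p 0 ` D p \<and> s \<in> \<phi> p 1 ` D p \<and> k \<in> \<phi> p (c + 2) ` D p"
    if "T c r s k \<noteq> 0" for c r s k
    using that by (auto simp: T_def W_def split: if_splits)
  have famD: "alternating (D p) (\<lambda>z. F p c x y z)" "alternating (D p) (\<lambda>z. F p c x z y)"
      "alternating (D p) (\<lambda>z. F p c z x y)"
    if "p \<in> P" "c < t" "x \<in> D p" "y \<in> D p" for p c x y
    using fam[OF that(1)] that by (auto simp: italian_family_def)
  have "italian_family t A T"
    unfolding italian_family_def
  proof (intro conjI allI impI ballI)
    fix c r s assume c: "c < t" and rs: "r \<in> A" "s \<in> A"
    show "alternating A (\<lambda>z. T c r s z)"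
    proof -
      obtain p x y where p: "p \<in> P" "x \<in> D p" "y \<in> D p" "r = \<phi> p 0 x" "s = \<phi> p 1 y"
        using cover[of 0 1, OF _ _ _ rs] by auto
      show ?thesis
      proof (rule alternating_extend[OF fin mono[OF p(1)] into[OF p(1)]])
        show "T c r s k = 0" if "k \<notin> \<phi> p (c + 2) ` D p" for k
        proof (rule ccontr)
          assume "T c r s k \<noteq> 0"
          then obtain p' where p': "p' \<in> P" "r \<in> \<phi> p' 0 ` D p'" "s \<in> \<phi> p' 1 ` D p'"
            "k \<in> \<phi> p' (c + 2) ` D p'" using supp by blast
          have "p = p'" using p p' by (intro unique[of 0 1 p p' r s]) auto
          with that p' show False by simp
        qed
        show "alternating (D p) (\<lambda>b. T c r s (\<phi> p (c + 2) b))"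
          using famD(1)[OF p(1) c p(2,3)] val[OF c p(1-3)] unfolding p(4,5)
          by (simp cong: alternating_cong)
      qed (use c in auto)
    qed
    show "alternating A (\<lambda>z. T c r z s)"
    proof -
      obtain p x y where p: "p \<in> P" "x \<in> D p" "y \<in> D p" "r = \<phi> p 0 x" "s = \<phi> p (c + 2) y"
        using cover[of 0 "c + 2", OF _ _ _ rs] c by auto
      show ?thesis
      proof (rule alternating_extend[OF fin mono[OF p(1)] into[OF p(1)]])
        show "T c r k s = 0" if "k \<notin> \<phi> p 1 ` D p" for k
        proof (rule ccontr)
          assume "T c r k s \<noteq> 0"
          then obtain p' where p': "p' \<in> P" "r \<in> \<phi> p' 0 ` D p'" "k \<in> \<phi> p' 1 ` D p'"
            "s \<in> \<phi> p' (c + 2) ` D p'" using supp by blast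
          have "p = p'" using p p' c by (intro unique[of 0 "c + 2" p p' r s]) auto
          with that p' show False by simp
        qed
        show "alternating (D p) (\<lambda>b. T c r (\<phi> p 1 b) s)"
          using famD(2)[OF p(1) c p(2,3)] val[OF c p(1,2) _ p(3)] unfolding p(4,5)
          by (simp cong: alternating_cong)
      qed (use c in auto)
    qed
    show "alternating A (\<lambda>z. T c z r s)"
    proof -
      obtain p x y where p: "p \<in> P" "x \<in> D p" "y \<in> D p" "r = \<phi> p 1 x" "s = \<phi> p (c + 2) y"
        using cover[of 1 "c + 2", OF _ _ _ rs] c by auto
      show ?thesis
      proof (rule alternating_extend[OF fin mono[OF p(1)] into[OF p(1)]])
        show "T c k r s = 0" if "k \<notin> \<phi> p 0 ` D p" for k
        proof (rule ccontr)
          assume "T c k r s \<noteq> 0"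
          then obtain p' where p': "p' \<in> P" "k \<in> \<phi> p' 0 ` D p'" "r \<in> \<phi> p' 1 ` D p'"
            "s \<in> \<phi> p' (c + 2) ` D p'" using supp by blast
          have "p = p'" using p p' c by (intro unique[of 1 "c + 2" p p' r s]) auto
          with that p' show False by simp
        qed
        show "alternating (D p) (\<lambda>b. T c (\<phi> p 0 b) r s)"
          using famD(3)[OF p(1) c p(2,3)] val[OF c p(1) _ p(2,3)] unfolding p(4,5)
          by (simp cong: alternating_cong)
      qed (use c in auto)
    qed
  next
    fix c d k l assume c: "c < t" and d: "d < t" and "c \<noteq> d" and kl: "k \<in> A" "l \<in> A"
    obtain p x y where p: "p \<in> P" "x \<in> D p" "y \<in> D p" "k = \<phi> p (c + 2) x" "l = \<phi> p (d + 2) y"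
      using cover[of "c + 2" "d + 2", OF _ _ _ kl] c d \<open>c \<noteq> d\<close> by auto
    have off: "T c i j k * T d i j l = 0" if "i \<notin> \<phi> p 0 ` D p \<or> j \<notin> \<phi> p 1 ` D p" for i j
    proof (rule ccontr)
      assume "T c i j k * T d i j l \<noteq> 0"
      then obtain p1 p2 where
        p1: "p1 \<in> P" "i \<in> \<phi> p1 0 ` D p1" "j \<in> \<phi> p1 1 ` D p1" "k \<in> \<phi> p1 (c + 2) ` D p1" and
        p2: "p2 \<in> P" "i \<in> \<phi> p2 0 ` D p2" "j \<in> \<phi> p2 1 ` D p2" "l \<in> \<phi> p2 (d + 2) ` D p2"
        using supp[of c i j k] supp[of d i j l] by auto
      have "p1 = p2" using unique[of 0 1 p1 p2 i j] p1 p2 by simp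
      moreover have "p1 = p" if "l \<in> \<phi> p1 (d + 2) ` D p1"
        using unique[of "c + 2" "d + 2" p1 p k l] p1 p that c d \<open>c \<noteq> d\<close> by simp
      ultimately show False using that p1 p2 by blast
    qed
    have "(\<Sum>i\<in>A. \<Sum>j\<in>A. T c i j k * T d i j l) =
        (\<Sum>i\<in>\<phi> p 0 ` D p. \<Sum>j\<in>\<phi> p 1 ` D p. T c i j k * T d i j l)"
    proof -
      have "(\<Sum>i\<in>A. \<Sum>j\<in>A. T c i j k * T d i j l) =
          (\<Sum>i\<in>\<phi> p 0 ` D p. \<Sum>j\<in>A. T c i j k * T d i j l)"
        using fin into[OF p(1), of 0] off by (intro sum.mono_neutral_right) (auto intro!: sum.neutral)
      also have "\<dots> = (\<Sum>i\<in>\<phi> p 0 ` D p. \<Sum>j\<in>\<phi> p 1 ` D p. T c i j k * T d i j l)"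
        using fin into[OF p(1), of 1] off by (intro sum.cong sum.mono_neutral_right) auto
      finally show ?thesis .
    qed
    also have "\<dots> = (\<Sum>i\<in>D p. \<Sum>j\<in>D p. F p c i j x * F p d i j y)"
      using inj[OF p(1), of 0] inj[OF p(1), of 1] val[OF c p(1)] val[OF d p(1)] p
      by (simp add: sum.reindex)
    also have "\<dots> = 1"
      using fam[OF p(1)] c d \<open>c \<noteq> d\<close> p(2,3) by (auto simp: italian_family_def)
    finally show "(\<Sum>i\<in>A. \<Sum>j\<in>A. T c i j k * T d i j l) = 1" .
  qed
  with val show ?thesis by (intro that)
qed

section \<open>Orthogonal arrays\<close>

text \<open>The rows of the array are indexed by \<open>D \<times> D\<close> and its \<open>q\<close> columns by \<open>i < q\<close>. With \<open>q = t + 2\<close>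
this is a set of \<open>t\<close> mutually orthogonal Latin squares, with no column singled out as rows or
columns of the squares.\<close>

definition orthogonal_array :: "nat \<Rightarrow> nat set \<Rightarrow> (nat \<Rightarrow> nat \<Rightarrow> nat \<Rightarrow> nat) \<Rightarrow> bool" where
  "orthogonal_array q D Q \<longleftrightarrow>
     (\<forall>i<q. \<forall>j<q. i \<noteq> j \<longrightarrow> bij_betw (\<lambda>(x, y). (Q i x y, Q j x y)) (D \<times> D) (D \<times> D))"

lemma orthogonal_arrayI:
  assumes "finite D"
    and range: "\<And>i x y. i < q \<Longrightarrow> x \<in> D \<Longrightarrow> y \<in> D \<Longrightarrow> Q i x y \<in> D"
    and inj: "\<And>i j x y x' y'. i < j \<Longrightarrow> j < q \<Longrightarrow> x \<in> D \<Longrightarrow> y \<in> D \<Longrightarrow> x' \<in> D \<Longrightarrow> y' \<in> D \<Longrightarrow>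
        Q i x y = Q i x' y' \<Longrightarrow> Q j x y = Q j x' y' \<Longrightarrow> x = x' \<and> y = y'"
  shows "orthogonal_array q D Q"
  unfolding orthogonal_array_def
proof (intro allI impI)
  fix i j assume ij: "i < q" "j < q" "i \<noteq> j"
  let ?f = "\<lambda>(x, y). (Q i x y, Q j x y)"
  have "inj_on ?f (D \<times> D)"
  proof (rule inj_onI, clarsimp)
    fix x y x' y'
    assume "x \<in> D" "y \<in> D" "x' \<in> D" "y' \<in> D" "Q i x y = Q i x' y'" "Q j x y = Q j x' y'"
    then show "x = x' \<and> y = y'"
      using inj[of i j x y x' y'] inj[of j i x y x' y'] ij by (cases "i < j") auto
  qed
  moreover have "?f ` (D \<times> D) \<subseteq> D \<times> D" using range ij by auto
  ultimately show "bij_betw ?f (D \<times> D) (D \<times> D)"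
    using assms(1) by (simp add: bij_betw_def endo_inj_surj)
qed

lemma orthogonal_array_range:
  assumes "orthogonal_array q D Q" "2 \<le> q" "i < q" "x \<in> D" "y \<in> D"
  shows "Q i x y \<in> D"
proof -
  obtain j where "j < q" "i \<noteq> j"
    using that[of 0] that[of 1] assms(2,3) by (cases "i = 0") auto
  then have "bij_betw (\<lambda>(x, y). (Q i x y, Q j x y)) (D \<times> D) (D \<times> D)"
    using assms(1,3) by (simp add: orthogonal_array_def)
  from bij_betwE[OF this] show ?thesis using assms(4,5) by force
qed

lemma orthogonal_array_ex:
  assumes "orthogonal_array q D Q" "i < q" "j < q" "i \<noteq> j" "a \<in> D" "b \<in> D"
  obtains x y where "x \<in> D" "y \<in> D" "Q i x y = a" "Q j x y = b"
proof -
  have "(a, b) \<in> (\<lambda>(x, y). (Q i x y, Q j x y)) ` (D \<times> D)"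
    using assms by (auto simp: orthogonal_array_def bij_betw_def)
  then show ?thesis using that by auto
qed

lemma orthogonal_array_unique:
  assumes "orthogonal_array q D Q" "i < q" "j < q" "i \<noteq> j"
    and "x \<in> D" "y \<in> D" "x' \<in> D" "y' \<in> D" "Q i x y = Q i x' y'" "Q j x y = Q j x' y'"
  shows "x = x' \<and> y = y'"
proof -
  have "inj_on (\<lambda>(x, y). (Q i x y, Q j x y)) (D \<times> D)"
    using assms by (auto simp: orthogonal_array_def bij_betw_def)
  from inj_onD[OF this, of "(x, y)" "(x', y')"] show ?thesis using assms by auto
qed

text \<open>The lines of the affine plane over \<open>\<int>/g\<close> with \<open>q\<close> consecutive slopes \<open>\<infinity>, 0, 1, \<dots>, q - 2\<close>. Two
such families of parallel lines meet properly because the difference of two finite slopes is at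
most \<open>q - 2\<close> and hence invertible. For \<open>g\<close> without small prime factors this gives as many
columns as the constructions below ask for.\<close>

lemma cyclic_orthogonal_array:
  assumes "\<And>d. 0 < d \<Longrightarrow> d + 2 \<le> q \<Longrightarrow> coprime d g"
  shows "orthogonal_array q {..<g} (\<lambda>i x y. if i = 0 then y else (x + (i - 1) * y) mod g)"
proof (rule orthogonal_arrayI)
  fix i j x y x' y'
  assume ij: "i < j" "j < q" and xy: "x \<in> {..<g}" "y \<in> {..<g}" "x' \<in> {..<g}" "y' \<in> {..<g}"
  assume eqi: "(if i = 0 then y else (x + (i - 1) * y) mod g) =
      (if i = 0 then y' else (x' + (i - 1) * y') mod g)"
    and eqj: "(if j = 0 then y else (x + (j - 1) * y) mod g) =
      (if j = 0 then y' else (x' + (j - 1) * y') mod g)"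
  have dvd: "int g dvd (int x - int x') + int (k - 1) * (int y - int y')"
    if "(x + (k - 1) * y) mod g = (x' + (k - 1) * y') mod g" for k
  proof -
    have "int (x + (k - 1) * y) mod int g = int (x' + (k - 1) * y') mod int g"
      using that by (simp only: zmod_int[symmetric])
    then have "int g dvd int (x + (k - 1) * y) - int (x' + (k - 1) * y')"
      by (rule mod_eq_dvd_iff[THEN iffD1])
    also have "int (x + (k - 1) * y) - int (x' + (k - 1) * y') =
        (int x - int x') + int (k - 1) * (int y - int y')"
      by (simp only: of_nat_add of_nat_mult) (simp add: right_diff_distrib)
    finally show ?thesis .
  qed
  have small: "a = b" if "int g dvd int a - int b" "a < g" "b < g" for a b
  proof -
    have "int a mod int g = int b mod int g" using that(1) by (simp add: mod_eq_dvd_iff)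
    then show ?thesis using that by simp
  qed
  have j: "int g dvd (int x - int x') + int (j - 1) * (int y - int y')"
    using dvd[of j] eqj ij by simp
  have "y = y'"
  proof (cases "i = 0")
    case False
    have "int g dvd (int x - int x') + int (i - 1) * (int y - int y')"
      using dvd[of i] eqi False by simp
    from dvd_diff[OF j this] have "int g dvd (int (j - 1) - int (i - 1)) * (int y - int y')"
      by (simp add: algebra_simps)
    also have "int (j - 1) - int (i - 1) = int (j - i)" using ij False by simp
    finally have "int g dvd int (j - i) * (int y - int y')" .
    moreover have "coprime (int g) (int (j - i))"
      using assms[of "j - i"] ij False
      by (simp add: coprime_commute del: of_nat_diff)
    ultimately have "int g dvd int y - int y'" by (simp add: coprime_dvd_mult_right_iff)
    then show ?thesis using small xy by simp
  qed (use eqi in simp)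
  then show "x = x' \<and> y = y'" using j small xy by simp
qed auto

lemma orthogonal_array_mono: "orthogonal_array q D Q \<Longrightarrow> p \<le> q \<Longrightarrow> orthogonal_array p D Q"
  by (simp add: orthogonal_array_def)

text \<open>Mutually orthogonal Latin squares, seen as a gluing of parts of order \<open>1\<close>.\<close>

lemma orthogonal_array_imp_italian:
  assumes Q: "orthogonal_array (t + 2) {..<n} Q"
  shows "italian_set_exists t n"
proof -
  obtain T where "italian_family t {..<n} T"
  proof (rule italian_family_glue[where A = "{..<n}" and t = t and P = "{..<n} \<times> {..<n}"
        and D = "\<lambda>_. {0::nat}" and F = "\<lambda>_ _ _ _ _. 1" and \<phi> = "\<lambda>(x, y) i _. Q i x y"])
    show "(case p of (x, y) \<Rightarrow> \<lambda>i _. Q i x y) i ` {0} \<subseteq> {..<n}"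
      if "p \<in> {..<n} \<times> {..<n}" "i < t + 2" for p i
      using that orthogonal_array_range[OF Q] by (auto split: prod.splits)
    show "\<exists>p\<in>{..<n} \<times> {..<n}. r \<in> (case p of (x, y) \<Rightarrow> \<lambda>i _. Q i x y) i ` {0} \<and>
        s \<in> (case p of (x, y) \<Rightarrow> \<lambda>i _. Q i x y) j ` {0}"
      if rs: "i < t + 2" "j < t + 2" "i \<noteq> j" "r \<in> {..<n}" "s \<in> {..<n}" for i j r s
    proof -
      obtain x y where "x \<in> {..<n}" "y \<in> {..<n}" "Q i x y = r" "Q j x y = s"
        using orthogonal_array_ex[OF Q rs] .
      then show ?thesis by (intro bexI[of _ "(x, y)"]) auto
    qed
    show "p = p'"
      if "i < t + 2" "j < t + 2" "i \<noteq> j" "p \<in> {..<n} \<times> {..<n}" "p' \<in> {..<n} \<times> {..<n}"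
        "r \<in> (case p of (x, y) \<Rightarrow> \<lambda>i _. Q i x y) i ` {0}"
        "s \<in> (case p of (x, y) \<Rightarrow> \<lambda>i _. Q i x y) j ` {0}"
        "r \<in> (case p' of (x, y) \<Rightarrow> \<lambda>i _. Q i x y) i ` {0}"
        "s \<in> (case p' of (x, y) \<Rightarrow> \<lambda>i _. Q i x y) j ` {0}" for i j p p' r s
      using that orthogonal_array_unique[OF Q that(1-3)] by (auto split: prod.splits)
  qed (auto simp: italian_family_singleton strict_mono_on_def)
  then show ?thesis unfolding italian_set_exists_def by blast
qed

lemma italian_set_exists_cyclic:
  assumes "\<And>d. 0 < d \<Longrightarrow> d \<le> t \<Longrightarrow> coprime d n"
  shows "italian_set_exists t n"
  by (rule orthogonal_array_imp_italian, rule cyclic_orthogonal_array) (use assms in auto)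

section \<open>Wilson's construction\<close>

text \<open>The points of copy \<open>i\<close> are \<open>(z, a)\<close> with \<open>z < g\<close> and \<open>a < m\<close>, together with \<open>u1\<close> points \<open>(g, e)\<close>
and \<open>u2\<close> points \<open>(g + 1, e)\<close> at infinity. The master array \<open>M\<close> has a column for each copy and
two more. Its row \<open>(x, y)\<close> is a block: it selects the points \<open>(M i x y, a)\<close> with \<open>a < m\<close> of each
copy \<open>i\<close>, and the additional columns \<open>t + 2\<close> and \<open>t + 3\<close> say which points at infinity the block
contains, if any. So a block has \<open>m\<close>, \<open>m + 1\<close> or \<open>m + 2\<close> points in each copy. On a block without
points at infinity the family \<open>B\<close> is used. On the others an orthogonal array is used that has
the constant row \<open>(e, \<dots>, e)\<close> for each local name \<open>e \<in> {m, m + 1}\<close> of a point at infinity. These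
rows are left out and every other row forms a part of order \<open>1\<close>, so that the pairs of points at
infinity of the same kind remain uncovered. They are covered by the two holes, which carry the
families \<open>F1\<close> and \<open>F2\<close>.\<close>

datatype part = Block nat nat | Tuple nat nat nat nat | Hole nat

locale wilson =
  fixes t g m u1 u2 :: nat
    and M :: "nat \<Rightarrow> nat \<Rightarrow> nat \<Rightarrow> nat"
    and Q :: "nat set \<Rightarrow> nat \<Rightarrow> nat \<Rightarrow> nat \<Rightarrow> nat"
    and B F1 F2 :: "nat \<Rightarrow> nat \<Rightarrow> nat \<Rightarrow> nat \<Rightarrow> int"
  assumes master: "orthogonal_array (t + 4) {..<g} M"
    and local_array: "X \<subseteq> {m, Suc m} \<Longrightarrow> X \<noteq> {} \<Longrightarrow> orthogonal_array (t + 2) ({..<m} \<union> X) (Q X)"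
    and local_diag: "X \<subseteq> {m, Suc m} \<Longrightarrow> e \<in> X \<Longrightarrow> i < t + 2 \<Longrightarrow> Q X i e e = e"
    and local_family: "italian_family t {..<m} B"
    and fill1: "italian_family t {..<u1} F1"
    and fill2: "italian_family t {..<u2} F2"
    and u_le: "u1 \<le> g" "u2 \<le> g"
begin

definition points :: "(nat \<times> nat) set" where
  "points = {..<g} \<times> {..<m} \<union> {g} \<times> {..<u1} \<union> {Suc g} \<times> {..<u2}"

text \<open>The local names of the points at infinity on the block \<open>(x, y)\<close>.\<close>

definition extra :: "nat \<Rightarrow> nat \<Rightarrow> nat set" where
  "extra x y = (if M (t + 2) x y < u1 then {m} else {}) \<union> (if M (t + 3) x y < u2 then {Suc m} else {})"

text \<open>The point of copy \<open>i\<close> with local name \<open>d\<close> on the block \<open>(x, y)\<close>.\<close>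

definition loc :: "nat \<Rightarrow> nat \<Rightarrow> nat \<Rightarrow> nat \<Rightarrow> nat \<times> nat" where
  "loc x y i d = (if d < m then (M i x y, d) else if d = m then (g, M (t + 2) x y) else (Suc g, M (t + 3) x y))"

text \<open>The column of the master array that decides which point of copy \<open>i\<close> has the local name \<open>d\<close>.\<close>

definition coord :: "nat \<Rightarrow> nat \<Rightarrow> nat" where
  "coord i d = (if d < m then i else if d = m then t + 2 else t + 3)"

definition parts :: "part set" where
  "parts = {Block x y | x y. x < g \<and> y < g \<and> extra x y = {}} \<union>
     {Tuple x y a b | x y a b. x < g \<and> y < g \<and> extra x y \<noteq> {} \<and>
        a \<in> {..<m} \<union> extra x y \<and> b \<in> {..<m} \<union> extra x y \<and> \<not> (a = b \<and> m \<le> a)} \<union>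
     {Hole 0, Hole 1}"

fun cells :: "part \<Rightarrow> nat set" where
  "cells (Block x y) = {..<m}"
| "cells (Tuple x y a b) = {0}"
| "cells (Hole h) = (if h = 0 then {..<u1} else {..<u2})"

fun emb :: "part \<Rightarrow> nat \<Rightarrow> nat \<Rightarrow> nat \<times> nat" where
  "emb (Block x y) i z = loc x y i z"
| "emb (Tuple x y a b) i z = loc x y i (Q (extra x y) i a b)"
| "emb (Hole h) i z = (g + h, z)"

fun fill :: "part \<Rightarrow> nat \<Rightarrow> nat \<Rightarrow> nat \<Rightarrow> nat \<Rightarrow> int" where
  "fill (Block x y) = B"
| "fill (Tuple x y a b) = (\<lambda>_ _ _ _. 1)"
| "fill (Hole h) = (if h = 0 then F1 else F2)"

lemma extra_sub: "extra x y \<subseteq> {m, Suc m}"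
  by (auto simp: extra_def)

lemma M_less: "i < t + 4 \<Longrightarrow> x < g \<Longrightarrow> y < g \<Longrightarrow> M i x y < g"
  using orthogonal_array_range[OF master, of i x y] by simp

lemma finite_points: "finite points"
  by (simp add: points_def)

lemma card_points: "card points = m * g + u1 + u2"
  by (subst points_def, subst card_Un_disjoint; (subst card_Un_disjoint)?)
     (auto simp: card_cartesian_product)

lemma loc_in_points:
  assumes "i < t + 2" "x < g" "y < g" "d \<in> {..<m} \<union> extra x y"
  shows "loc x y i d \<in> points"
  using assms M_less[of i x y] by (auto simp: points_def loc_def extra_def split: if_splits)

lemma loc_eqD:
  assumes "loc x y i d = loc x' y' i d'" "i < t + 2" "x < g" "y < g" "x' < g" "y' < g"
    "d \<le> Suc m" "d' \<le> Suc m"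
  shows "d = d' \<and> M (coord i d) x y = M (coord i d) x' y'"
  using assms M_less[of i x y] M_less[of i x' y'] by (auto simp: loc_def coord_def split: if_splits)

lemma fst_loc:
  assumes "i < t + 2" "x < g" "y < g" "d \<le> Suc m"
  shows "d < m \<and> fst (loc x y i d) < g \<or> m \<le> d \<and> fst (loc x y i d) = g + (d - m)"
  using assms M_less[of i x y] by (auto simp: loc_def)

text \<open>Two points from different copies, not at infinity of the same kind, are decided by two different
columns of the master array. Existence and uniqueness of a common block are therefore existence
and uniqueness of a row of \<open>M\<close> with two prescribed entries.\<close>

lemma block_unique:
  assumes "loc x y i d = loc x' y' i e" "loc x y j d' = loc x' y' j e'"
    and "i < t + 2" "j < t + 2" "i \<noteq> j" "x < g" "y < g" "x' < g" "y' < g"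
    and "d \<le> Suc m" "d' \<le> Suc m" "e \<le> Suc m" "e' \<le> Suc m" "\<not> (d = d' \<and> m \<le> d)"
  shows "x = x' \<and> y = y' \<and> d = e \<and> d' = e'"
proof -
  have 1: "d = e \<and> M (coord i d) x y = M (coord i d) x' y'"
    using assms by (intro loc_eqD) auto
  have 2: "d' = e' \<and> M (coord j d') x y = M (coord j d') x' y'"
    using assms by (intro loc_eqD) auto
  have "coord i d \<noteq> coord j d'" "coord i d < t + 4" "coord j d' < t + 4"
    using assms by (auto simp: coord_def)
  then have "x = x' \<and> y = y'"
    using 1 2 assms by (intro orthogonal_array_unique[OF master]) auto
  with 1 2 show ?thesis by simp
qed

lemma point_cases:
  assumes "r \<in> points" "i < t + 2"
  obtains d a where "d \<le> Suc m" "a < g"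
    and "\<And>x y. M (coord i d) x y = a \<Longrightarrow> loc x y i d = r \<and> d \<in> {..<m} \<union> extra x y"
    and "d < m \<or> fst r = g + (d - m)"
proof -
  from assms(1) consider z d where "r = (z, d)" "z < g" "d < m" | e where "r = (g, e)" "e < u1"
    | e where "r = (Suc g, e)" "e < u2" unfolding points_def by auto
  then show ?thesis
  proof cases
    case 1 then show ?thesis by (intro that[of d z]) (auto simp: coord_def loc_def)
  next
    case 2 then show ?thesis
      using u_le by (intro that[of m e]) (auto simp: coord_def loc_def extra_def)
  next
    case 3 then show ?thesis
      using u_le by (intro that[of "Suc m" e]) (auto simp: coord_def loc_def extra_def)
  qed
qed

lemma block_through:
  assumes "r \<in> points" "s \<in> points" "i < t + 2" "j < t + 2" "i \<noteq> j"
    and "\<not> (fst r = fst s \<and> g \<le> fst r)"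
  obtains x y d d' where "x < g" "y < g" "d \<in> {..<m} \<union> extra x y" "d' \<in> {..<m} \<union> extra x y"
    and "loc x y i d = r" "loc x y j d' = s" "\<not> (d = d' \<and> m \<le> d)"
proof -
  obtain d a where d: "d \<le> Suc m" "a < g" "d < m \<or> fst r = g + (d - m)"
    "\<And>x y. M (coord i d) x y = a \<Longrightarrow> loc x y i d = r \<and> d \<in> {..<m} \<union> extra x y"
    using point_cases[OF assms(1,3)] by metis
  obtain d' a' where d': "d' \<le> Suc m" "a' < g" "d' < m \<or> fst s = g + (d' - m)"
    "\<And>x y. M (coord j d') x y = a' \<Longrightarrow> loc x y j d' = s \<and> d' \<in> {..<m} \<union> extra x y"
    using point_cases[OF assms(2,4)] by metis
  \<comment> \<open>The same name of a point at infinity would put both points into the same hole.\<close>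
  have nd: "\<not> (d = d' \<and> m \<le> d)" using d(3) d'(3) assms(6) by auto
  then have "coord i d \<noteq> coord j d'" "coord i d < t + 4" "coord j d' < t + 4"
    using assms d(1) d'(1) by (auto simp: coord_def)
  then obtain x y where "x \<in> {..<g}" "y \<in> {..<g}" "M (coord i d) x y = a" "M (coord j d') x y = a'"
    using orthogonal_array_ex[OF master] d(2) d'(2) by (metis lessThan_iff)
  with d(4) d'(4) nd show ?thesis by (intro that[of x y d d']) auto
qed

lemma local_range:
  assumes "X \<subseteq> {m, Suc m}" "X \<noteq> {}" "i < t + 2" "a \<in> {..<m} \<union> X" "b \<in> {..<m} \<union> X"
  shows "Q X i a b \<in> {..<m} \<union> X"
  using orthogonal_array_range[OF local_array[OF assms(1,2)]] assms by simp

text \<open>The row \<open>(e, \<dots>, e)\<close> is the only one of the local array with \<open>e\<close> in two columns, so deleting it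
uncovers exactly the pair \<open>(e, e)\<close>.\<close>

lemma local_off_diag:
  assumes X: "X \<subseteq> {m, Suc m}" "X \<noteq> {}" and ij: "i < t + 2" "j < t + 2" "i \<noteq> j"
    and ab: "a \<in> {..<m} \<union> X" "b \<in> {..<m} \<union> X" "\<not> (a = b \<and> m \<le> a)"
  shows "\<not> (Q X i a b = Q X j a b \<and> m \<le> Q X i a b)"
proof
  let ?e = "Q X i a b"
  assume eq: "?e = Q X j a b \<and> m \<le> ?e"
  then have e: "?e \<in> X" using local_range[OF X ij(1) ab(1,2)] by auto
  have "a = ?e \<and> b = ?e"
    using e eq local_diag[OF X(1) e] ij ab
    by (intro orthogonal_array_unique[OF local_array[OF X] ij]) auto
  with ab(3) eq show False by metis
qed

text \<open>Every part except the holes lies on a block, where its points have local names that are not the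
same name of a point at infinity. Whether it is the whole block or a row of the local array, it
can be recovered from the block and two of these names.\<close>

lemma tuple_or_block:
  assumes p: "p \<in> parts" "\<And>h. p \<noteq> Hole h" and ij: "i < t + 2" "j < t + 2" "i \<noteq> j"
    and z: "z \<in> cells p" "z' \<in> cells p"
  obtains x y d d' where "x < g" "y < g" "d \<in> {..<m} \<union> extra x y" "d' \<in> {..<m} \<union> extra x y"
    and "emb p i z = loc x y i d" "emb p j z' = loc x y j d'" "\<not> (d = d' \<and> m \<le> d)"
    and "p = Block x y \<and> extra x y = {} \<or> 
      (\<exists>a b. p = Tuple x y a b \<and> extra x y \<noteq> {} \<and>
           a \<in> {..<m} \<union> extra x y \<and> b \<in> {..<m} \<union> extra x y \<and>
         Q (extra x y) i a b = d \<and> Q (extra x y) j a b = d')"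
proof (cases p)
  case (Block x y)
  then show ?thesis using p z by (intro that[of x y z z']) (auto simp: parts_def)
next
  case (Tuple x y a b)
  then have *: "x < g" "y < g" "extra x y \<noteq> {}" "a \<in> {..<m} \<union> extra x y" "b \<in> {..<m} \<union> extra x y"
    "\<not> (a = b \<and> m \<le> a)" using p(1) by (auto simp: parts_def)
  show ?thesis
    using * Tuple local_range[OF extra_sub] local_off_diag[OF extra_sub *(3) ij *(4-6)] ij
    by (intro that[of x y "Q (extra x y) i a b" "Q (extra x y) j a b"]) auto
qed (use p in auto)

lemma extra_le: "d \<in> {..<m} \<union> extra x y \<Longrightarrow> d \<le> Suc m"
  using extra_sub[of x y] by auto

lemma parts_cover:
  assumes ij: "i < t + 2" "j < t + 2" "i \<noteq> j" and rs: "r \<in> points" "s \<in> points"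
  shows "\<exists>p\<in>parts. r \<in> emb p i ` cells p \<and> s \<in> emb p j ` cells p"
proof (cases "fst r = fst s \<and> g \<le> fst r")
  case True
  then consider "fst r = g" "fst s = g" "snd r < u1" "snd s < u1"
    | "fst r = g + 1" "fst s = g + 1" "snd r < u2" "snd s < u2"
    using rs by (auto simp: points_def)
  then show ?thesis
  proof cases
    case 1 then show ?thesis
      by (intro bexI[of _ "Hole 0"]) (auto simp: parts_def image_iff prod_eq_iff)
  next
    case 2 then show ?thesis
      by (intro bexI[of _ "Hole 1"]) (auto simp: parts_def image_iff prod_eq_iff)
  qed
next
  case False
  then obtain x y d d' where xy: "x < g" "y < g"
    and d: "d \<in> {..<m} \<union> extra x y" "d' \<in> {..<m} \<union> extra x y"
    and loc: "loc x y i d = r" "loc x y j d' = s" and nd: "\<not> (d = d' \<and> m \<le> d)"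
    using block_through[OF rs ij] by metis
  show ?thesis
  proof (cases "extra x y = {}")
    case True
    then show ?thesis
      using xy d loc by (intro bexI[of _ "Block x y"]) (auto simp: parts_def)
  next
    case False
    obtain a b where ab: "a \<in> {..<m} \<union> extra x y" "b \<in> {..<m} \<union> extra x y"
      "Q (extra x y) i a b = d" "Q (extra x y) j a b = d'"
      using orthogonal_array_ex[OF local_array[OF extra_sub False] ij d] .
    have "\<not> (a = b \<and> m \<le> a)"
    proof
      assume "a = b \<and> m \<le> a"
      then have "d = a" "d' = a"
        using ab ij local_diag[OF extra_sub, of a x y] by auto
      with nd \<open>a = b \<and> m \<le> a\<close> show False by simp
    qed
    then have "Tuple x y a b \<in> parts" using xy ab(1,2) False by (auto simp: parts_def)
    then show ?thesis using ab loc by (intro bexI[of _ "Tuple x y a b"]) auto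
  qed
qed

lemma hole_or_not:
  assumes p: "p \<in> parts" "\<And>h. p \<noteq> Hole h" and ij: "i < t + 2" "j < t + 2" "i \<noteq> j"
    and z: "z \<in> cells p" "z' \<in> cells p"
  shows "\<not> (fst (emb p i z) = g + h \<and> fst (emb p j z') = g + h)"
proof -
  obtain x y d d' where *: "x < g" "y < g" "d \<in> {..<m} \<union> extra x y" "d' \<in> {..<m} \<union> extra x y"
    "emb p i z = loc x y i d" "emb p j z' = loc x y j d'" "\<not> (d = d' \<and> m \<le> d)"
    using tuple_or_block[OF assms] by metis
  show ?thesis
    using fst_loc[OF ij(1) *(1,2) extra_le[OF *(3)]] fst_loc[OF ij(2) *(1,2) extra_le[OF *(4)]] *(5-7)
    by auto
qed

lemma parts_unique:
  assumes ij: "i < t + 2" "j < t + 2" "i \<noteq> j" and p: "p \<in> parts" "p' \<in> parts"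
    and r: "r \<in> emb p i ` cells p" "s \<in> emb p j ` cells p" "r \<in> emb p' i ` cells p'" "s \<in> emb p' j ` cells p'"
  shows "p = p'"
proof -
  obtain z1 z2 w1 w2 where zw: "z1 \<in> cells p" "z2 \<in> cells p" "w1 \<in> cells p'" "w2 \<in> cells p'"
    "r = emb p i z1" "s = emb p j z2" "r = emb p' i w1" "s = emb p' j w2" using r by blast
  consider h where "p = Hole h" | h where "p' = Hole h"
    | "\<And>h. p \<noteq> Hole h" "\<And>h. p' \<noteq> Hole h" by blast
  then show ?thesis
  proof cases
    case 1
    then have fst: "fst r = g + h" "fst s = g + h" using zw(5,6) by simp_all
    then obtain h' where "p' = Hole h'"
      using hole_or_not[OF p(2) _ ij zw(3,4), of h] zw(7,8) by metis
    with fst zw 1 show ?thesis by simp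
  next
    case 2
    then have fst: "fst r = g + h" "fst s = g + h" using zw(7,8) by simp_all
    then obtain h' where "p = Hole h'"
      using hole_or_not[OF p(1) _ ij zw(1,2), of h] zw(5,6) by metis
    with fst zw 2 show ?thesis by simp
  next
    case 3
    obtain x y d d' where xy: "x < g" "y < g" "d \<in> {..<m} \<union> extra x y" "d' \<in> {..<m} \<union> extra x y"
      "emb p i z1 = loc x y i d" "emb p j z2 = loc x y j d'" "\<not> (d = d' \<and> m \<le> d)"
      and eq: "p = Block x y \<and> extra x y = {} \<or>
        (\<exists>a b. p = Tuple x y a b \<and> extra x y \<noteq> {} \<and>
           a \<in> {..<m} \<union> extra x y \<and> b \<in> {..<m} \<union> extra x y \<and>
           Q (extra x y) i a b = d \<and> Q (extra x y) j a b = d')"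
      using tuple_or_block[OF p(1) 3(1) ij zw(1,2)] .
    obtain x' y' e e' where xy': "x' < g" "y' < g" "e \<in> {..<m} \<union> extra x' y'" "e' \<in> {..<m} \<union> extra x' y'"
      "emb p' i w1 = loc x' y' i e" "emb p' j w2 = loc x' y' j e'" "\<not> (e = e' \<and> m \<le> e)"
      and eq': "p' = Block x' y' \<and> extra x' y' = {} \<or>
        (\<exists>a b. p' = Tuple x' y' a b \<and> extra x' y' \<noteq> {} \<and>
           a \<in> {..<m} \<union> extra x' y' \<and> b \<in> {..<m} \<union> extra x' y' \<and>
           Q (extra x' y') i a b = e \<and> Q (extra x' y') j a b = e')"
      using tuple_or_block[OF p(2) 3(2) ij zw(3,4)] .
    have same: "x = x' \<and> y = y' \<and> d = e \<and> d' = e'"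
      using zw xy xy' ij
      by (intro block_unique[OF _ _ ij] extra_le[OF xy(3)] extra_le[OF xy(4)] extra_le[OF xy'(3)] extra_le[OF xy'(4)]) auto
    show ?thesis
    proof (cases "extra x y = {}")
      case True
      then show ?thesis using eq eq' same by auto
    next
      case False
      then obtain a b a' b' where
        ab: "p = Tuple x y a b" "a \<in> {..<m} \<union> extra x y" "b \<in> {..<m} \<union> extra x y"
          "Q (extra x y) i a b = d" "Q (extra x y) j a b = d'" and
        ab': "p' = Tuple x y a' b'" "a' \<in> {..<m} \<union> extra x y" "b' \<in> {..<m} \<union> extra x y"
          "Q (extra x y) i a' b' = d" "Q (extra x y) j a' b' = d'"
        using eq eq' same by auto
      have "a = a' \<and> b = b'"
        using ab ab' by (intro orthogonal_array_unique[OF local_array[OF extra_sub False] ij]) auto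
      with ab ab' show ?thesis by simp
    qed
  qed
qed

lemma emb_in_points: "p \<in> parts \<Longrightarrow> i < t + 2 \<Longrightarrow> emb p i ` cells p \<subseteq> points"
proof (cases p)
  case (Block x y)
  then show "p \<in> parts \<Longrightarrow> i < t + 2 \<Longrightarrow> ?thesis"
    by (auto simp: parts_def intro!: loc_in_points)
next
  case (Tuple x y a b)
  then show "p \<in> parts \<Longrightarrow> i < t + 2 \<Longrightarrow> ?thesis"
    using local_range[OF extra_sub, of x y i a b] by (auto simp: parts_def intro!: loc_in_points)
next
  case (Hole h)
  then show "p \<in> parts \<Longrightarrow> i < t + 2 \<Longrightarrow> ?thesis" by (auto simp: parts_def points_def)
qed

lemma emb_strict_mono: "p \<in> parts \<Longrightarrow> strict_mono_on (cells p) (emb p i)"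
  by (cases p) (auto simp: strict_mono_on_def less_prod_def loc_def parts_def)

lemma fill_family: "p \<in> parts \<Longrightarrow> italian_family t (cells p) (fill p)"
  using local_family fill1 fill2 italian_family_singleton[of t 0]
  by (cases p) (auto simp: parts_def)

lemma family_exists:
  obtains T where "italian_family t points T"
    and "\<And>c i j k. c < t \<Longrightarrow> i < u1 \<Longrightarrow> j < u1 \<Longrightarrow> k < u1 \<Longrightarrow> T c (g, i) (g, j) (g, k) = F1 c i j k"
    and "\<And>c x y i j k. c < t \<Longrightarrow> x < g \<Longrightarrow> y < g \<Longrightarrow> extra x y = {} \<Longrightarrow> i < m \<Longrightarrow> j < m \<Longrightarrow> k < m \<Longrightarrow>
      T c (M 0 x y, i) (M 1 x y, j) (M (c + 2) x y, k) = B c i j k"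
proof -
  obtain T where T: "italian_family t points T"
    "\<And>c p x y z. c < t \<Longrightarrow> p \<in> parts \<Longrightarrow> x \<in> cells p \<Longrightarrow> y \<in> cells p \<Longrightarrow> z \<in> cells p \<Longrightarrow>
        T c (emb p 0 x) (emb p 1 y) (emb p (c + 2) z) = fill p c x y z"
  proof (rule italian_family_glue[where P = parts and D = cells and F = fill and \<phi> = emb and t = t,
        OF finite_points])
    show "italian_family t (cells p) (fill p)" if "p \<in> parts" for p
      using that by (rule fill_family)
    show "strict_mono_on (cells p) (emb p i)" if "p \<in> parts" for p i
      using that by (rule emb_strict_mono)
    show "emb p i ` cells p \<subseteq> points" if "p \<in> parts" "i < t + 2" for p i
      using that by (rule emb_in_points)
  qed (use parts_cover parts_unique in blast)+
  show ?thesis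
  proof (rule that[OF T(1)])
    show "T c (g, i) (g, j) (g, k) = F1 c i j k" if "c < t" "i < u1" "j < u1" "k < u1" for c i j k
      using T(2)[of c "Hole 0" i j k] that by (simp add: parts_def)
    show "T c (M 0 x y, i) (M 1 x y, j) (M (c + 2) x y, k) = B c i j k"
      if "c < t" "x < g" "y < g" "extra x y = {}" "i < m" "j < m" "k < m" for c x y i j k
      using T(2)[of c "Block x y" i j k] that by (simp add: parts_def loc_def)
  qed
qed

lemma untouched_block:
  assumes "u1 < g" "u2 < g"
  obtains x y where "x < g" "y < g" "extra x y = {}"
proof -
  obtain x y where "x \<in> {..<g}" "y \<in> {..<g}" "M (t + 2) x y = u1" "M (t + 3) x y = u2"
    using orthogonal_array_ex[OF master, of "t + 2" "t + 3" u1 u2] assms by auto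
  then show ?thesis by (intro that[of x y]) (auto simp: extra_def)
qed

text \<open>Negative entries come either from the first hole or from a block that avoids all points at
infinity, which exists if neither of the extra columns is used up.\<close>

theorem non_latin_set_exists_wilson:
  assumes "\<And>c. c < t \<Longrightarrow> (\<exists>i<u1. \<exists>j<u1. \<exists>k<u1. F1 c i j k < 0) \<or>
      u1 < g \<and> u2 < g \<and> (\<exists>i<m. \<exists>j<m. \<exists>k<m. B c i j k < 0)"
  shows "non_latin_set_exists t (m * g + u1 + u2)"
proof -
  obtain T where T: "italian_family t points T"
    and T1: "\<And>c i j k. c < t \<Longrightarrow> i < u1 \<Longrightarrow> j < u1 \<Longrightarrow> k < u1 \<Longrightarrow> T c (g, i) (g, j) (g, k) = F1 c i j k"
    and TB: "\<And>c x y i j k. c < t \<Longrightarrow> x < g \<Longrightarrow> y < g \<Longrightarrow> extra x y = {} \<Longrightarrow> i < m \<Longrightarrow> j < m \<Longrightarrow> k < m \<Longrightarrow>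
      T c (M 0 x y, i) (M 1 x y, j) (M (c + 2) x y, k) = B c i j k"
    using family_exists by blast
  have "non_latin_set_exists t (card points)"
  proof (rule non_latin_set_existsI[OF finite_points T])
    fix c assume c: "c < t"
    show "\<exists>x\<in>points. \<exists>y\<in>points. \<exists>z\<in>points. T c x y z < 0"
      using assms[OF c]
    proof (elim disjE exE conjE)
      fix i j k assume "i < u1" "j < u1" "k < u1" "F1 c i j k < 0"
      moreover from this have "(g, i) \<in> points" "(g, j) \<in> points" "(g, k) \<in> points"
        by (auto simp: points_def)
      ultimately show ?thesis using T1[OF c, of i j k] by force
    next
      fix i j k assume ijk: "i < m" "j < m" "k < m" "B c i j k < 0" and u: "u1 < g" "u2 < g"
      obtain x y where xy: "x < g" "y < g" "extra x y = {}" using untouched_block[OF u] .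
      then have "(M 0 x y, i) \<in> points" "(M 1 x y, j) \<in> points" "(M (c + 2) x y, k) \<in> points"
        using M_less[of 0 x y] M_less[of 1 x y] M_less[of "c + 2" x y] ijk c by (auto simp: points_def)
      then show ?thesis using TB[OF c xy ijk(1-3)] ijk(4) by force
    qed
  qed
  then show ?thesis by (simp add: card_points)
qed

end

lemma orthogonal_array_relabel:
  assumes Q: "orthogonal_array q D Q" and q: "2 \<le> q" and fin: "finite E"
    and \<sigma>: "\<And>x. x \<in> E \<Longrightarrow> \<sigma> x \<in> D" "\<And>x. x \<in> E \<Longrightarrow> \<tau> (\<sigma> x) = x"
    and \<tau>: "\<And>x. x \<in> D \<Longrightarrow> \<tau> x \<in> E" "\<And>x. x \<in> D \<Longrightarrow> \<sigma> (\<tau> x) = x"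
  shows "orthogonal_array q E (\<lambda>i x y. \<tau> (Q i (\<sigma> x) (\<sigma> y)))"
proof (rule orthogonal_arrayI[OF fin])
  fix i x y assume "i < q" "x \<in> E" "y \<in> E"
  then show "\<tau> (Q i (\<sigma> x) (\<sigma> y)) \<in> E"
    using orthogonal_array_range[OF Q q] \<sigma>(1) \<tau>(1) by simp
next
  fix i j x y x' y'
  assume ij: "i < j" "j < q" and xy: "x \<in> E" "y \<in> E" "x' \<in> E" "y' \<in> E"
    and eq: "\<tau> (Q i (\<sigma> x) (\<sigma> y)) = \<tau> (Q i (\<sigma> x') (\<sigma> y'))"
      "\<tau> (Q j (\<sigma> x) (\<sigma> y)) = \<tau> (Q j (\<sigma> x') (\<sigma> y'))"
  have "Q k (\<sigma> x) (\<sigma> y) = Q k (\<sigma> x') (\<sigma> y')"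
    if "k < q" "\<tau> (Q k (\<sigma> x) (\<sigma> y)) = \<tau> (Q k (\<sigma> x') (\<sigma> y'))" for k
    using orthogonal_array_range[OF Q q that(1)] \<sigma>(1) xy \<tau>(2) that(2) by metis
  then have "\<sigma> x = \<sigma> x' \<and> \<sigma> y = \<sigma> y'"
    using ij eq xy \<sigma>(1) by (intro orthogonal_array_unique[OF Q, of i j]) auto
  then show "x = x' \<and> y = y'" using xy \<sigma>(2) by metis
qed

text \<open>The master array is the cyclic one, so that all slopes from \<open>1\<close> to \<open>t + 2\<close> must be invertible
modulo \<open>g\<close>. If a block meets only the second kind of points at infinity, its local points are
named \<open>0, \<dots>, m - 1, m + 1\<close>, and the array of order \<open>m + 1\<close> is transported along the
transposition \<open>sw\<close> of \<open>m\<close> and \<open>m + 1\<close>.\<close>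

lemma wilson_construction:
  assumes g: "\<And>d. 0 < d \<Longrightarrow> d \<le> t + 2 \<Longrightarrow> coprime d g"
    and V: "orthogonal_array (t + 2) {..<m + 1} V" "\<And>i. i < t + 2 \<Longrightarrow> V i m m = m"
    and W: "orthogonal_array (t + 2) {..<m + 2} W"
      "\<And>i e. i < t + 2 \<Longrightarrow> e \<in> {m, m + 1} \<Longrightarrow> W i e e = e"
    and fam: "italian_family t {..<m} B" "italian_family t {..<u1} F1" "italian_family t {..<u2} F2"
    and u: "u1 \<le> g" "u2 \<le> g"
    and neg: "\<And>c. c < t \<Longrightarrow> (\<exists>i<u1. \<exists>j<u1. \<exists>k<u1. F1 c i j k < 0) \<or>
      u1 < g \<and> u2 < g \<and> (\<exists>i<m. \<exists>j<m. \<exists>k<m. B c i j k < 0)"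
  shows "non_latin_set_exists t (m * g + u1 + u2)"
proof -
  define sw where "sw x = (if x = m then Suc m else if x = Suc m then m else x)" for x
  define Q where "Q X = (if X = {m} then V else if X = {Suc m} then (\<lambda>i x y. sw (V i (sw x) (sw y))) else W)"
    for X
  have cases: "X = {m} \<or> X = {Suc m} \<or> X = {m, Suc m}" if "X \<subseteq> {m, Suc m}" "X \<noteq> {}" for X
    using that by blast
  have sets: "{..<m} \<union> {m} = {..<m + 1}" "{..<m} \<union> {m, Suc m} = {..<m + 2}" by auto
  have Q: "Q {m} = V" "Q {Suc m} = (\<lambda>i x y. sw (V i (sw x) (sw y)))" "Q {m, Suc m} = W"
    by (auto simp: Q_def)
  interpret wilson t g m u1 u2 "\<lambda>i x y. if i = 0 then y else (x + (i - 1) * y) mod g" Q B F1 F2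
  proof
    show "orthogonal_array (t + 4) {..<g} (\<lambda>i x y. if i = 0 then y else (x + (i - 1) * y) mod g)"
      by (rule cyclic_orthogonal_array) (use g in auto)
    have "orthogonal_array (t + 2) ({..<m} \<union> {Suc m}) (\<lambda>i x y. sw (V i (sw x) (sw y)))"
      by (rule orthogonal_array_relabel[OF V(1)]) (auto simp: sw_def split: if_splits)
    then show "orthogonal_array (t + 2) ({..<m} \<union> X) (Q X)" if "X \<subseteq> {m, Suc m}" "X \<noteq> {}" for X
      using cases[OF that] V(1) W(1) by (elim disjE) (simp_all only: Q sets)
    show "Q X i e e = e" if "X \<subseteq> {m, Suc m}" "e \<in> X" "i < t + 2" for X e i
    proof -
      have "X \<noteq> {}" using that(2) by blast
      from cases[OF that(1) this] show ?thesis
      proof (elim disjE)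
        assume "X = {m}" then show ?thesis using that V(2) by (simp add: Q)
      next
        assume "X = {Suc m}" then show ?thesis using that V(2) by (simp add: Q) (simp add: sw_def)
      next
        assume "X = {m, Suc m}" then show ?thesis using that W(2) by (simp add: Q)
      qed
    qed
  qed (use fam u in auto)
  show ?thesis using non_latin_set_exists_wilson[OF neg] .
qed

section \<open>Latin squares over small fields\<close>

text \<open>Squares are given by their rows. The columns of the array are flattened to lists, so that
orthogonality of two of them becomes distinctness of a list of pairs.\<close>

definition array_columns :: "nat \<Rightarrow> nat list list list \<Rightarrow> nat list list" where
  "array_columns n Ts =
     concat (map (replicate n) [0..<n]) # concat (replicate n [0..<n]) # map concat Ts"

definition array_check :: "nat \<Rightarrow> nat list list \<Rightarrow> bool" where
  "array_check n cs \<longleftrightarrow> (\<forall>c\<in>set cs. length c = n * n \<and> (\<forall>a\<in>set c. a < n)) \<and>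
     sorted_wrt (\<lambda>c d. distinct (zip c d)) cs"

definition table_array :: "nat \<Rightarrow> nat list list list \<Rightarrow> nat \<Rightarrow> nat \<Rightarrow> nat \<Rightarrow> nat" where
  "table_array n Ts i x y = array_columns n Ts ! i ! (n * x + y)"

lemma row_index_less:
  assumes "x < n" "y < n"
  shows "n * x + y < n * (n::nat)"
proof -
  have "n * x + y < n * Suc x" using assms by simp
  also have "\<dots> \<le> n * n" using assms by (intro mult_left_mono) auto
  finally show ?thesis .
qed

lemma table_arrayI:
  assumes "array_check n (array_columns n Ts)"
  shows "orthogonal_array (length Ts + 2) {..<n} (table_array n Ts)"
proof (rule orthogonal_arrayI)
  let ?c = "array_columns n Ts"
  have len: "length ?c = length Ts + 2" by (simp add: array_columns_def)
  have col: "length (?c ! i) = n * n" "\<And>a. a \<in> set (?c ! i) \<Longrightarrow> a < n" if "i < length Ts + 2" for i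
    using assms nth_mem[of i ?c] that unfolding array_check_def len by auto
  fix i x y assume "i < length Ts + 2" "x \<in> {..<n}" "y \<in> {..<n}"
  then show "table_array n Ts i x y \<in> {..<n}"
    using col[of i] row_index_less[of x n y] nth_mem[of "n * x + y" "?c ! i"] by (simp add: table_array_def)
next
  let ?c = "array_columns n Ts"
  have len: "length ?c = length Ts + 2" by (simp add: array_columns_def)
  fix i j x y x' y'
  assume ij: "i < j" "j < length Ts + 2"
    and xy: "x \<in> {..<n}" "y \<in> {..<n}" "x' \<in> {..<n}" "y' \<in> {..<n}"
    and eq: "table_array n Ts i x y = table_array n Ts i x' y'"
      "table_array n Ts j x y = table_array n Ts j x' y'"
  have l: "length (?c ! i) = n * n" "length (?c ! j) = n * n"
    using assms nth_mem[of i ?c] nth_mem[of j ?c] ij unfolding array_check_def len by auto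
  have "distinct (zip (?c ! i) (?c ! j))"
    using assms sorted_wrt_nth_less[of "\<lambda>c d. distinct (zip c d)" ?c i j] ij
    unfolding array_check_def len by simp
  then have "n * x + y = n * x' + y'"
    using row_index_less[of x n y] row_index_less[of x' n y'] xy eq l
      nth_eq_iff_index_eq[of "zip (?c ! i) (?c ! j)" "n * x + y" "n * x' + y'"]
    by (simp add: table_array_def)
  moreover have "(n * x + y) div n = x" "(n * x' + y') div n = x'" using xy by simp_all
  ultimately show "x = x' \<and> y = y'" by simp
qed simp

text \<open>Over a finite field with \<open>q\<close> elements the squares \<open>(1 - \<lambda>) x + \<lambda> y\<close>, for \<open>\<lambda>\<close> different from \<open>0\<close>
and \<open>1\<close>, are Latin, mutually orthogonal, and have \<open>x\<close> in the diagonal cell \<open>(x, x)\<close>; so the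
constant rows required by the construction above are there. The tables give such squares for
\<open>q = 4, 5, 8, 9\<close>, where an element is written as the number whose base \<open>p\<close> digits are its
coefficients with respect to the powers of a generator \<open>\<alpha>\<close> of the field, with \<open>\<alpha>\<^sup>2 = \<alpha> + 1\<close>,
\<open>\<alpha>\<^sup>3 = \<alpha> + 1\<close> and \<open>\<alpha>\<^sup>2 = -1\<close> for \<open>q = 4, 8, 9\<close>. The values of \<open>\<lambda>\<close> are \<open>2, 3\<close> and, for
\<open>q = 8, 9\<close>, also \<open>4\<close>. The third square of order \<open>4\<close> is \<open>x + y\<close>, which is orthogonal to the other
two but not of this form.\<close>

definition table_4 :: "nat list list list" where
  "table_4 =
    [[[0,2,3,1],
      [3,1,0,2],
      [1,3,2,0],
      [2,0,1,3]],
     [[0,3,1,2],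
      [2,1,3,0],
      [3,0,2,1],
      [1,2,0,3]],
     [[0,1,2,3],
      [1,0,3,2],
      [2,3,0,1],
      [3,2,1,0]]]"

definition table_5 :: "nat list list list" where
  "table_5 =
    [[[0,2,4,1,3],
      [4,1,3,0,2],
      [3,0,2,4,1],
      [2,4,1,3,0],
      [1,3,0,2,4]],
     [[0,3,1,4,2],
      [3,1,4,2,0],
      [1,4,2,0,3],
      [4,2,0,3,1],
      [2,0,3,1,4]]]"

definition table_8 :: "nat list list list" where
  "table_8 =
    [[[0,2,4,6,3,1,7,5],
      [3,1,7,5,0,2,4,6],
      [6,4,2,0,5,7,1,3],
      [5,7,1,3,6,4,2,0],
      [7,5,3,1,4,6,0,2],
      [4,6,0,2,7,5,3,1],
      [1,3,5,7,2,0,6,4],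
      [2,0,6,4,1,3,5,7]],
     [[0,3,6,5,7,4,1,2],
      [2,1,4,7,5,6,3,0],
      [4,7,2,1,3,0,5,6],
      [6,5,0,3,1,2,7,4],
      [3,0,5,6,4,7,2,1],
      [1,2,7,4,6,5,0,3],
      [7,4,1,2,0,3,6,5],
      [5,6,3,0,2,1,4,7]],
     [[0,4,3,7,6,2,5,1],
      [5,1,6,2,3,7,0,4],
      [1,5,2,6,7,3,4,0],
      [4,0,7,3,2,6,1,5],
      [2,6,1,5,4,0,7,3],
      [7,3,4,0,1,5,2,6],
      [3,7,0,4,5,1,6,2],
      [6,2,5,1,0,4,3,7]]]"

definition table_9 :: "nat list list list" where
  "table_9 =
    [[[0,2,1,6,8,7,3,5,4],
      [2,1,0,8,7,6,5,4,3],
      [1,0,2,7,6,8,4,3,5],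
      [6,8,7,3,5,4,0,2,1],
      [8,7,6,5,4,3,2,1,0],
      [7,6,8,4,3,5,1,0,2],
      [3,5,4,0,2,1,6,8,7],
      [5,4,3,2,1,0,8,7,6],
      [4,3,5,1,0,2,7,6,8]],
     [[0,3,6,2,5,8,1,4,7],
      [7,1,4,6,0,3,8,2,5],
      [5,8,2,4,7,1,3,6,0],
      [4,7,1,3,6,0,5,8,2],
      [2,5,8,1,4,7,0,3,6],
      [6,0,3,8,2,5,7,1,4],
      [8,2,5,7,1,4,6,0,3],
      [3,6,0,5,8,2,4,7,1],
      [1,4,7,0,3,6,2,5,8]],
     [[0,4,8,5,6,1,7,2,3],
      [6,1,5,2,3,7,4,8,0],
      [3,7,2,8,0,4,1,5,6],
      [1,5,6,3,7,2,8,0,4],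
      [7,2,3,0,4,8,5,6,1],
      [4,8,0,6,1,5,2,3,7],
      [2,3,7,4,8,0,6,1,5],
      [8,0,4,1,5,6,3,7,2],
      [5,6,1,7,2,3,0,4,8]]]"

lemma orthogonal_array_4: "orthogonal_array 5 {..<4} (table_array 4 table_4)"
proof -
  have "array_check 4 (array_columns 4 table_4)" by code_simp
  moreover have "length table_4 = 3" by (simp add: table_4_def)
  ultimately show ?thesis using table_arrayI[of 4 table_4] by (simp add: numeral_eq_Suc)
qed

lemma orthogonal_array_5: "orthogonal_array 4 {..<5} (table_array 5 table_5)"
proof -
  have "array_check 5 (array_columns 5 table_5)" by code_simp
  moreover have "length table_5 = 2" by (simp add: table_5_def)
  ultimately show ?thesis using table_arrayI[of 5 table_5] by (simp add: numeral_eq_Suc)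
qed

lemma orthogonal_array_8: "orthogonal_array 5 {..<8} (table_array 8 table_8)"
proof -
  have "array_check 8 (array_columns 8 table_8)" by code_simp
  moreover have "length table_8 = 3" by (simp add: table_8_def)
  ultimately show ?thesis using table_arrayI[of 8 table_8] by (simp add: numeral_eq_Suc)
qed

lemma orthogonal_array_9: "orthogonal_array 5 {..<9} (table_array 9 table_9)"
proof -
  have "array_check 9 (array_columns 9 table_9)" by code_simp
  moreover have "length table_9 = 3" by (simp add: table_9_def)
  ultimately show ?thesis using table_arrayI[of 9 table_9] by (simp add: numeral_eq_Suc)
qed

lemma diag_4: "\<forall>i\<in>{..<4}. table_array 4 table_4 i 3 3 = 3" by code_simp
lemma diag_5: "\<forall>i\<in>{..<4}. \<forall>e\<in>{3, 4}. table_array 5 table_5 i e e = e" by code_simp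
lemma diag_8: "\<forall>i\<in>{..<5}. table_array 8 table_8 i 7 7 = 7" by code_simp
lemma diag_9: "\<forall>i\<in>{..<5}. \<forall>e\<in>{7, 8}. table_array 9 table_9 i e e = e" by code_simp

section \<open>Small Italian squares\<close>

fun partial_sums_ok :: "int \<Rightarrow> int list \<Rightarrow> bool" where
  "partial_sums_ok s [] \<longleftrightarrow> s = 1"
| "partial_sums_ok s (x # xs) \<longleftrightarrow> (s + x = 0 \<or> s + x = 1) \<and> partial_sums_ok (s + x) xs"

lemma partial_sums_okD:
  "partial_sums_ok s xs \<Longrightarrow> s + sum_list xs = 1 \<and> (\<forall>i<length xs. s + sum_list (take (Suc i) xs) \<in> {0, 1})"
proof (induction xs arbitrary: s)
  case (Cons x xs)
  then have "s + x \<in> {0, 1}" "s + x + sum_list xs = 1"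
    "\<forall>i<length xs. s + x + sum_list (take (Suc i) xs) \<in> {0, 1}"
    using Cons.IH[of "s + x"] by auto
  then show ?case by (auto simp: less_Suc_eq_0_disj add.assoc)
qed simp

lemma alternating_nth:
  assumes "partial_sums_ok 0 xs"
  shows "alternating {..<length xs} (\<lambda>i. xs ! i)"
proof -
  have "{x \<in> {..<length xs}. x \<le> a} = {..<Suc a}" if "a < length xs" for a
    using that by auto
  moreover have "sum ((!) xs) {..<Suc a} = sum_list (take (Suc a) xs)" if "a < length xs" for a
  proof -
    have "length (take (Suc a) xs) = Suc a" using that by simp
    then have "sum_list (take (Suc a) xs) = sum ((!) (take (Suc a) xs)) {..<Suc a}"
      by (simp only: sum_list_sum_nth atLeast0LessThan)
    also have "\<dots> = sum ((!) xs) {..<Suc a}" by (intro sum.cong) auto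
    finally show ?thesis by simp
  qed
  moreover have "sum ((!) xs) {..<length xs} = sum_list xs"
    by (simp add: sum_list_sum_nth atLeast0LessThan)
  ultimately show ?thesis
    using partial_sums_okD[OF assms] by (simp add: alternating_def)
qed

text \<open>A table lists in each cell the signed symbols of its formal sum; \<open>coefficients\<close> turns a cell
into the list of its \<open>n\<close> coefficients.\<close>

definition coefficients :: "nat \<Rightarrow> int list \<Rightarrow> int list" where
  "coefficients n cell = map (\<lambda>k. if k \<in> set cell then 1 else if - k \<in> set cell then - 1 else 0) [1..int n]"

definition plane :: "int list list list \<Rightarrow> nat \<Rightarrow> int list list" where
  "plane X k = map (map (\<lambda>cell. cell ! k)) X"

definition square_check :: "nat \<Rightarrow> int list list list \<Rightarrow> bool" where
  "square_check n X \<longleftrightarrow>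
     length X = n \<and> (\<forall>row\<in>set X. length row = n \<and>
       (\<forall>cell\<in>set row. length cell = n \<and> partial_sums_ok 0 cell)) \<and>
     (\<forall>P\<in>set (map (plane X) [0..<n]). (\<forall>row\<in>set P. partial_sums_ok 0 row) \<and>
       (\<forall>j\<in>set [0..<n]. partial_sums_ok 0 (map (\<lambda>row. row ! j) P))) \<and>
     (\<exists>row\<in>set X. \<exists>cell\<in>set row. \<exists>a\<in>set cell. a < 0)"

definition inner :: "int list list \<Rightarrow> int list list \<Rightarrow> int" where
  "inner P P' = sum_list (map2 (\<lambda>r s. sum_list (map2 (*) r s)) P P')"

definition orthogonality_check :: "nat \<Rightarrow> int list list list \<Rightarrow> int list list list \<Rightarrow> bool" where
  "orthogonality_check n X Y \<longleftrightarrow>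
     (\<forall>P\<in>set (map (plane X) [0..<n]). \<forall>P'\<in>set (map (plane Y) [0..<n]). inner P P' = 1)"

definition family_check :: "nat \<Rightarrow> int list list list list \<Rightarrow> bool" where
  "family_check n Ts \<longleftrightarrow> (let Xs = map (map (map (coefficients n))) Ts in
     (\<forall>X\<in>set Xs. square_check n X) \<and> sorted_wrt (orthogonality_check n) Xs)"

text \<open>The check inspects each unordered pair of squares once; symmetry of the inner product gives the
other order.\<close>

lemma non_latin_set_exists_table:
  assumes "family_check n Ts"
  shows "non_latin_set_exists (length Ts) n"
proof -
  define Xs where "Xs = map (map (map (coefficients n))) Ts"
  define L where "L c i j k = Xs ! c ! i ! j ! k" for c i j k
  have len: "length Xs = length Ts" by (simp add: Xs_def)
  have sq: "square_check n (Xs ! c)" if "c < length Ts" for c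
    using assms that len unfolding family_check_def Xs_def[symmetric] Let_def by simp
  have shape: "length (Xs ! c) = n" "\<And>i. i < n \<Longrightarrow> length (Xs ! c ! i) = n"
    "\<And>i j. i < n \<Longrightarrow> j < n \<Longrightarrow> length (Xs ! c ! i ! j) = n" if "c < length Ts" for c
    using sq[OF that] unfolding square_check_def by (auto simp: all_set_conv_all_nth)
  have lines: "alternating {..<n} (\<lambda>z. L c x y z)" "alternating {..<n} (\<lambda>z. L c x z y)"
    "alternating {..<n} (\<lambda>z. L c z x y)" if "c < length Ts" "x < n" "y < n" for c x y
  proof -
    have "partial_sums_ok 0 (Xs ! c ! x ! y)"
      using sq[OF that(1)] shape(1,2)[OF that(1)] that unfolding square_check_def
      by (auto simp: all_set_conv_all_nth)
    from alternating_nth[OF this] show "alternating {..<n} (\<lambda>z. L c x y z)"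
      using shape[OF that(1)] that by (simp add: L_def)
    have "plane (Xs ! c) y \<in> set (map (plane (Xs ! c)) [0..<n])" using that by simp
    then have P: "\<forall>row\<in>set (plane (Xs ! c) y). partial_sums_ok 0 row"
      "\<forall>j\<in>set [0..<n]. partial_sums_ok 0 (map (\<lambda>row. row ! j) (plane (Xs ! c) y))"
      using sq[OF that(1)] unfolding square_check_def by blast+
    have row: "plane (Xs ! c) y ! x = map (\<lambda>cell. cell ! y) (Xs ! c ! x)"
      using shape[OF that(1)] that by (simp add: plane_def)
    have "partial_sums_ok 0 (map (\<lambda>cell. cell ! y) (Xs ! c ! x))"
      using P(1) row shape[OF that(1)] that nth_mem[of x "plane (Xs ! c) y"]
      by (simp add: plane_def)
    from alternating_nth[OF this] show "alternating {..<n} (\<lambda>z. L c x z y)"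
      using shape[OF that(1)] that
        alternating_cong[of "{..<n}" "(!) (map (\<lambda>cell. cell ! y) (Xs ! c ! x))" "\<lambda>z. L c x z y"]
      by (simp add: L_def)
    have "partial_sums_ok 0 (map (\<lambda>row. row ! x) (plane (Xs ! c) y))" using P(2) that by simp
    from alternating_nth[OF this] show "alternating {..<n} (\<lambda>z. L c z x y)"
      using shape[OF that(1)] that
        alternating_cong[of "{..<n}" "(!) (map (\<lambda>row. row ! x) (plane (Xs ! c) y))" "\<lambda>z. L c z x y"]
      by (simp add: L_def plane_def)
  qed
  have orth: "(\<Sum>i<n. \<Sum>j<n. L c i j k * L d i j l) = 1"
    if cd: "c < d" "d < length Ts" and kl: "k < n" "l < n" for c d k l
  proof -
    have "orthogonality_check n (Xs ! c) (Xs ! d)"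
      using assms sorted_wrt_nth_less[of "orthogonality_check n" Xs c d] cd len
      unfolding family_check_def Xs_def[symmetric] Let_def by simp
    then have "inner (plane (Xs ! c) k) (plane (Xs ! d) l) = 1"
      using kl unfolding orthogonality_check_def by simp
    moreover have "inner (plane (Xs ! c) k) (plane (Xs ! d) l) = (\<Sum>i<n. \<Sum>j<n. L c i j k * L d i j l)"
      using shape[of c] shape[of d] cd
      by (simp add: inner_def plane_def sum_list_sum_nth L_def atLeast0LessThan)
    ultimately show ?thesis by simp
  qed
  have neg: "\<exists>x<n. \<exists>y<n. \<exists>z<n. L c x y z < 0" if "c < length Ts" for c
    using sq[OF that] shape[OF that] unfolding square_check_def L_def
    by (metis in_set_conv_nth)
  have "(\<Sum>i<n. \<Sum>j<n. L c i j k * L d i j l) = 1"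
    if "c \<noteq> d" "c < length Ts" "d < length Ts" "k < n" "l < n" for c d k l
    using orth[of c d k l] orth[of d c l k] that by (cases "c < d") (simp_all add: mult.commute)
  then have "italian_family (length Ts) {..<n} L"
    using lines unfolding italian_family_def by simp
  with neg show ?thesis unfolding non_latin_set_exists_def by blast
qed

text \<open>Sporadic families that start the constructions. They are Latin squares up to a few cells: the
coefficient \<open>-1\<close> occurs between one and four times in each square, and the lines through it
contain correspondingly more coefficients \<open>1\<close>. In the pair of order \<open>11\<close> each square has only
one cell with more than one symbol.\<close>

definition squares_5 :: "int list list list list" where
  "squares_5 =
    [[[[2], [3], [4], [1], [5]],
      [[4], [1], [3,-4,5], [4], [2]],
      [[1], [4], [2], [3,-4,5], [4]],
      [[3], [5], [4], [2], [1]],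
      [[5], [2], [1], [4], [3]]],
     [[[2], [1], [4], [3], [5]],
      [[3], [5], [2], [1], [4]],
      [[4], [2], [1,-2,3,-4,5], [4], [2]],
      [[5], [3], [4], [2], [1]],
      [[1], [4], [2], [5], [3]]]]"

definition squares_6 :: "int list list list list" where
  "squares_6 =
    [[[[4], [6], [5], [3], [1], [2]],
      [[5], [4], [3,-5,6], [5], [2], [1]],
      [[2], [1], [5], [6], [3], [4]],
      [[1], [5], [2], [4], [6], [3]],
      [[3], [2], [4], [1], [5], [6]],
      [[6], [3], [1], [2], [4], [5]]],
     [[[5], [4], [6], [1], [3], [2]],
      [[1], [3], [2], [5], [4], [6]],
      [[2], [1], [4], [3], [6], [5]],
      [[4], [2], [1,-2,3,-4,5], [2,-5,6], [5], [4]],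
      [[3], [6], [4], [5], [2], [1]],
      [[6], [5], [2], [4], [1], [3]]]]"

definition squares_7 :: "int list list list list" where
  "squares_7 =
    [[[[5], [7], [4], [2], [6], [3], [1]],
      [[1], [6], [5], [4], [3,-6,7], [2], [6]],
      [[3], [2], [1], [5], [6], [4], [7]],
      [[6], [5], [7], [3], [4], [1], [2]],
      [[7], [4], [3], [1,-3,6], [2], [5], [3]],
      [[4], [3], [2,-3,6], [3], [1], [7], [5]],
      [[2], [1], [3], [7], [5], [6], [4]]],
     [[[2], [6], [5], [3], [1], [4], [7]],
      [[1], [3], [7], [2], [4], [5], [6]],
      [[4], [2], [6], [1], [5], [3,-5,7], [5]],
      [[7], [4], [2], [5], [3,-5,6], [5], [1]],
      [[3], [1,-3,5], [3], [4], [7], [6], [2]],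
      [[5], [7], [4], [6], [2], [1], [3]],
      [[6], [3], [1], [7], [5], [2], [4]]],
     [[[1], [7], [5], [6], [2], [3], [4]],
      [[7], [3], [2], [4], [6], [1], [5]],
      [[5], [2], [3,-5,6], [5], [4], [7], [1]],
      [[6], [4], [5], [3,-5,7], [1], [2,-3,5], [3]],
      [[2], [6], [4], [1], [5], [3], [7]],
      [[3], [1], [7], [2,-3,5], [3], [4], [6]],
      [[4], [5], [1], [3], [7], [6], [2]]]]"

definition squares_11 :: "int list list list list" where
  "squares_11 =
    [[[[2], [8], [9], [4], [5], [7], [3], [6], [10], [1], [11]],
      [[7], [5], [6], [2], [8], [1], [11], [4], [9], [10], [3]],
      [[3], [6], [4], [7], [9], [8], [1], [5], [2], [11], [10]],
      [[5], [7], [3], [11], [1], [10], [4], [9], [6], [2], [8]],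
      [[9], [4], [7], [10], [11], [2], [8], [1], [5], [3], [6]],
      [[4], [1], [2], [8], [10], [9], [7], [11], [3], [6], [5]],
      [[1], [10], [11], [3], [4], [6], [5], [2,-4,7], [8], [4], [9]],
      [[8], [11], [1], [9], [2], [3], [6], [10], [7], [5], [4]],
      [[10], [9], [8], [5], [6], [4], [2], [3], [11], [7], [1]],
      [[6], [2], [5], [1], [3], [11], [10], [8], [4], [9], [7]],
      [[11], [3], [10], [6], [7], [5], [9], [4], [1], [8], [2]]],
     [[[8], [4], [7], [6], [11], [9], [5], [2], [1], [3], [10]],
      [[7], [2], [4], [9], [6], [5], [3], [11], [8], [10], [1]],
      [[9], [3], [5], [8], [1], [7], [4], [10], [6], [2], [11]],
      [[4], [11], [2], [5], [9], [3], [7], [6], [10], [1], [8]],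
      [[3], [1], [10], [4], [7], [2], [11], [8], [5], [6], [9]],
      [[2], [6], [11], [3], [5], [10], [1], [9], [4], [8], [7]],
      [[11], [9], [6], [7], [3,-7,10], [1], [8], [5], [2], [7], [4]],
      [[10], [8], [1], [2], [4], [11], [6], [7], [3], [9], [5]],
      [[6], [5], [9], [1], [7], [8], [10], [3], [11], [4], [2]],
      [[5], [7], [3], [10], [8], [4], [2], [1], [9], [11], [6]],
      [[1], [10], [8], [11], [2], [6], [9], [4], [7], [5], [3]]]]"

lemma non_latin_5: "non_latin_set_exists 2 5"
proof -
  have "family_check 5 squares_5" by code_simp
  from non_latin_set_exists_table[OF this] show ?thesis by (simp add: squares_5_def numeral_eq_Suc)
qed

lemma non_latin_6: "non_latin_set_exists 2 6"
proof -
  have "family_check 6 squares_6" by code_simp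
  from non_latin_set_exists_table[OF this] show ?thesis by (simp add: squares_6_def numeral_eq_Suc)
qed

lemma non_latin_7: "non_latin_set_exists 3 7"
proof -
  have "family_check 7 squares_7" by code_simp
  from non_latin_set_exists_table[OF this] show ?thesis by (simp add: squares_7_def numeral_eq_Suc)
qed

lemma non_latin_11: "non_latin_set_exists 2 11"
proof -
  have "family_check 11 squares_11" by code_simp
  from non_latin_set_exists_table[OF this] show ?thesis by (simp add: squares_11_def numeral_eq_Suc)
qed

section \<open>Squares from blocks of order 3 and 7\<close>

lemma coprime_prime_3:
  assumes "\<not> 3 dvd (g::nat)"
  shows "coprime 3 g"
proof (rule coprimeI)
  fix c :: nat assume c: "c dvd 3" "c dvd g"
  then have "c \<le> 3" by (simp add: dvd_imp_le)
  then have "c = 0 \<or> c = 1 \<or> c = 2 \<or> c = 3" by linarith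
  with c assms show "is_unit c" by auto
qed

lemma coprime_prime_5:
  assumes "\<not> 5 dvd (g::nat)"
  shows "coprime 5 g"
proof (rule coprimeI)
  fix c :: nat assume c: "c dvd 5" "c dvd g"
  then have "c \<le> 5" by (simp add: dvd_imp_le)
  then have "c = 0 \<or> c = 1 \<or> c = 2 \<or> c = 3 \<or> c = 4 \<or> c = 5" by linarith
  with c assms show "is_unit c" by auto
qed

lemma coprime_upto_4:
  assumes g: "odd (g::nat)" "\<not> 3 dvd g" and d: "0 < d" "d \<le> 4"
  shows "coprime d g"
proof -
  consider "d = 1" | "d = 2" | "d = 3" | "d = 2 * 2" using d by linarith
  then show ?thesis
  proof cases
    case 4
    show ?thesis unfolding 4 coprime_mult_left_iff using g(1) by simp
  qed (use g coprime_prime_3 in auto)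
qed

lemma coprime_upto_5:
  assumes "odd (g::nat)" "\<not> 3 dvd g" "\<not> 5 dvd g" "0 < d" "d \<le> 5"
  shows "coprime d g"
  using assms coprime_upto_4[of g d] coprime_prime_5[of g] by (cases "d = 5") auto

lemma italian_pair_odd:
  assumes "odd n"
  shows "italian_set_exists 2 n"
proof (rule italian_set_exists_cyclic)
  fix d :: nat assume "0 < d" "d \<le> 2"
  then have "d = 1 \<or> d = 2" by linarith
  then show "coprime d n" using assms by auto
qed

lemma italian_triple_coprime_6:
  assumes "odd n" "\<not> 3 dvd n"
  shows "italian_set_exists 3 n"
  by (rule italian_set_exists_cyclic) (use assms in \<open>auto intro: coprime_upto_4\<close>)

text \<open>Blocks of orders \<open>3\<close>, \<open>4\<close> and \<open>5\<close>, all of them Latin; the first hole contributes the negative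
entries.\<close>

lemma pair_from_base_3:
  assumes g: "odd g" "\<not> 3 dvd g" and u: "non_latin_set_exists 2 u1" "italian_set_exists 2 u2" "u1 \<le> g" "u2 \<le> g"
  shows "non_latin_set_exists 2 (3 * g + u1 + u2)"
proof -
  have cop: "coprime d g" if "0 < d" "d \<le> 4" for d using coprime_upto_4[OF g that] .
  have "italian_set_exists 2 3" by (rule italian_pair_odd) simp
  then obtain B where B: "italian_family 2 {..<3::nat} B" unfolding italian_set_exists_def by blast
  obtain F1 where F1: "italian_family 2 {..<u1} F1"
    and neg: "\<And>c. c < 2 \<Longrightarrow> \<exists>i<u1. \<exists>j<u1. \<exists>k<u1. F1 c i j k < 0"
    using u(1) unfolding non_latin_set_exists_def by blast
  obtain F2 where F2: "italian_family 2 {..<u2} F2" using u(2) unfolding italian_set_exists_def by blast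
  show ?thesis
    by (rule wilson_construction[where V = "table_array 4 table_4" and W = "table_array 5 table_5", OF _ _ _ _ _ B F1 F2])
       (use u neg cop orthogonal_array_4 orthogonal_array_5 diag_4 diag_5 in \<open>auto intro: orthogonal_array_mono\<close>)
qed

text \<open>Blocks of orders \<open>7\<close>, \<open>8\<close> and \<open>9\<close>. Here the blocks of order \<open>7\<close> contribute the negative entries,
and the holes may be Latin.\<close>

lemma triple_from_base_7:
  assumes g: "odd g" "\<not> 3 dvd g" "\<not> 5 dvd g"
    and u: "italian_set_exists 3 u1" "italian_set_exists 3 u2" "u1 < g" "u2 < g"
  shows "non_latin_set_exists 3 (7 * g + u1 + u2)"
proof -
  have cop: "coprime d g" if "0 < d" "d \<le> 5" for d using coprime_upto_5[OF g that] .
  obtain B where B: "italian_family 3 {..<7::nat} B"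
    and neg: "\<And>c. c < 3 \<Longrightarrow> \<exists>i<7::nat. \<exists>j<7::nat. \<exists>k<7::nat. B c i j k < 0"
    using non_latin_7 unfolding non_latin_set_exists_def by blast
  obtain F1 where F1: "italian_family 3 {..<u1} F1" using u(1) unfolding italian_set_exists_def by blast
  obtain F2 where F2: "italian_family 3 {..<u2} F2" using u(2) unfolding italian_set_exists_def by blast
  show ?thesis
    by (rule wilson_construction[where V = "table_array 8 table_8" and W = "table_array 9 table_9", OF _ _ _ _ _ B F1 F2])
       (use u neg cop orthogonal_array_8 orthogonal_array_9 diag_8 diag_9 in \<open>auto intro: orthogonal_array_mono\<close>)
qed

section \<open>All orders\<close>

text \<open>As \<open>n\<close> is even and \<open>g\<close> odd, one hole is odd and the other one is even. Subtracting the holes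
from \<open>n\<close> must leave a multiple of \<open>3\<close> but not of \<open>9\<close>. As \<open>5, 7\<close> and \<open>0, 4, 8\<close> have enough sums
modulo \<open>9\<close>, this can be arranged in each residue class; the bound \<open>40\<close> ensures that no hole is
larger than \<open>g\<close>.\<close>

lemma even_order_decomposition:
  assumes "even (n::nat)" "40 \<le> n"
  obtains g u1 u2 where "n = 3 * g + u1 + u2" "odd g" "\<not> 3 dvd g" "8 \<le> g" "u1 \<in> {5, 7}" "u2 \<in> {0, 4, 8}"
proof -
  define p where "p = n div 18 - 2"
  have "2 \<le> n div 18" using div_le_mono[OF assms(2), of 18] by simp
  then have "p + 2 = n div 18" by (simp add: p_def)
  then have "n = 18 * (p + 2) + n mod 18" by simp
  moreover have "n mod 18 < 18" "even (n mod 18)" using assms(1) by presburger+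
  then have "n mod 18 = 0 \<or> n mod 18 = 2 \<or> n mod 18 = 4 \<or> n mod 18 = 6 \<or> n mod 18 = 8
      \<or> n mod 18 = 10 \<or> n mod 18 = 12 \<or> n mod 18 = 14 \<or> n mod 18 = 16" by presburger
  ultimately consider "n = 18 * (p + 2) + 0"
    | "n = 18 * (p + 2) + 2"
    | "n = 18 * (p + 2) + 4"
    | "n = 18 * (p + 2) + 6"
    | "n = 18 * (p + 2) + 8"
    | "n = 18 * (p + 2) + 10"
    | "n = 18 * (p + 2) + 12"
    | "n = 18 * (p + 2) + 14"
    | "n = 18 * (p + 2) + 16"
    by metis
  then show ?thesis
  proof cases
    case 1
    have "odd (6 * p + 7)" "\<not> 3 dvd 6 * p + 7" by presburger+
    \<comment> \<open>For \<open>n = 36\<close> the hole of order \<open>8\<close> would be larger than \<open>g = 7\<close>.\<close>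
    moreover have "1 \<le> p" using 1 assms(2) by simp
    ultimately show ?thesis using 1 by (intro that[of "6 * p + 7" 7 8]) auto
  next
    case 2
    have "odd (6 * p + 11)" "\<not> 3 dvd 6 * p + 11" by presburger+
    then show ?thesis using 2 by (intro that[of "6 * p + 11" 5 0]) auto
  next
    case 3
    have "odd (6 * p + 11)" "\<not> 3 dvd 6 * p + 11" by presburger+
    then show ?thesis using 3 by (intro that[of "6 * p + 11" 7 0]) auto
  next
    case 4
    have "odd (6 * p + 11)" "\<not> 3 dvd 6 * p + 11" by presburger+
    then show ?thesis using 4 by (intro that[of "6 * p + 11" 5 4]) auto
  next
    case 5
    have "odd (6 * p + 13)" "\<not> 3 dvd 6 * p + 13" by presburger+
    then show ?thesis using 5 by (intro that[of "6 * p + 13" 5 0]) auto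
  next
    case 6
    have "odd (6 * p + 13)" "\<not> 3 dvd 6 * p + 13" by presburger+
    then show ?thesis using 6 by (intro that[of "6 * p + 13" 7 0]) auto
  next
    case 7
    have "odd (6 * p + 13)" "\<not> 3 dvd 6 * p + 13" by presburger+
    then show ?thesis using 7 by (intro that[of "6 * p + 13" 5 4]) auto
  next
    case 8
    have "odd (6 * p + 13)" "\<not> 3 dvd 6 * p + 13" by presburger+
    then show ?thesis using 8 by (intro that[of "6 * p + 13" 7 4]) auto
  next
    case 9
    have "odd (6 * p + 13)" "\<not> 3 dvd 6 * p + 13" by presburger+
    then show ?thesis using 9 by (intro that[of "6 * p + 13" 5 8]) auto
  qed
qed

lemma not_dvd_diff:
  assumes "v \<le> k" "k mod d \<noteq> v mod d"
  shows "\<not> d dvd k - (v::nat)"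
  using assms mod_eq_dvd_iff_nat[of v k d] by metis

text \<open>Here \<open>7 k = 7 g + u1 + u2\<close> with \<open>g = k - v\<close>. The number \<open>v\<close> has to be chosen such that \<open>g\<close> is
prime to \<open>30\<close> and \<open>7 v\<close> splits into two orders, both below \<open>g\<close>, for which three orthogonal Latin
squares are available. The second alternative in each class of \<open>k\<close> modulo \<open>6\<close> avoids multiples
of \<open>5\<close>. The excluded values of \<open>k\<close> are those where, with these choices, the holes would not be
smaller than \<open>g\<close>.\<close>

lemma triple_order_decomposition:
  assumes "even k \<or> 3 dvd k" "(k::nat) \<notin> {0, 2, 3, 4, 6, 8, 9, 10, 16}"
  shows "\<exists>v u1 u2. v < k \<and> odd (k - v) \<and> \<not> 3 dvd (k - v) \<and> \<not> 5 dvd (k - v) \<and> 7 * v = u1 + u2 \<and>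
     u1 < k - v \<and> u2 < k - v \<and> (u1, u2) \<in> {(7, 0), (7, 7), (13, 8), (17, 11), (19, 16)}"
proof -
  have ne: "k \<noteq> 0" "k \<noteq> 2" "k \<noteq> 3" "k \<noteq> 4" "k \<noteq> 6" "k \<noteq> 8" "k \<noteq> 9" "k \<noteq> 10" "k \<noteq> 16"
    using assms(2) by auto
  have "k mod 6 = 0 \<or> k mod 6 = 2 \<or> k mod 6 = 4 \<or> k mod 6 = 3" using assms(1) by presburger
  then consider "k mod 6 = 0 \<or> k mod 6 = 2" "k mod 5 \<noteq> 1" | "k mod 6 = 0" "k mod 5 = 1"
    | "k mod 6 = 2" "k mod 5 = 1" | "k mod 6 = 4" "k mod 5 \<noteq> 3" | "k mod 6 = 4" "k mod 5 = 3"
    | "k mod 6 = 3" "k mod 5 \<noteq> 2" | "k mod 6 = 3" "k mod 5 = 2"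
    by metis
  then show ?thesis
  proof cases
    case 1
    have lower: "10 < k" using 1(1) ne(1,2,5,6) by presburger
    have m: "k mod 2 = 0" "k mod 3 \<noteq> 1" using 1(1) by presburger+
    have "odd (k - 1)" "\<not> 3 dvd k - 1" "\<not> 5 dvd k - 1"
      by (rule not_dvd_diff; use lower m 1(2) in simp)+
    then show ?thesis using lower by (intro exI[of _ 1] exI[of _ 7] exI[of _ 0]) auto
  next
    case 2
    have lower: "35 < k" using 2 ne(5) by presburger
    have m: "k mod 2 = 0" "k mod 3 = 0" using 2(1) by presburger+
    have "odd (k - 5)" "\<not> 3 dvd k - 5" "\<not> 5 dvd k - 5"
      by (rule not_dvd_diff; use lower m 2(2) in simp)+
    then show ?thesis using lower by (intro exI[of _ 5] exI[of _ 19] exI[of _ 16]) auto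
  next
    case 3
    have lower: "25 < k" using 3 by presburger
    have m: "k mod 2 = 0" "k mod 3 = 2" using 3(1) by presburger+
    have "odd (k - 3)" "\<not> 3 dvd k - 3" "\<not> 5 dvd k - 3"
      by (rule not_dvd_diff; use lower m 3(2) in simp)+
    then show ?thesis using lower by (intro exI[of _ 3] exI[of _ 13] exI[of _ 8]) auto
  next
    case 4
    have lower: "16 < k" using 4(1) ne(4,8,9) by presburger
    have m: "k mod 2 = 0" "k mod 3 = 1" using 4(1) by presburger+
    have "odd (k - 3)" "\<not> 3 dvd k - 3" "\<not> 5 dvd k - 3"
      by (rule not_dvd_diff; use lower m 4(2) in simp)+
    then show ?thesis using lower by (intro exI[of _ 3] exI[of _ 13] exI[of _ 8]) auto
  next
    case 5
    have lower: "27 < k" using 5 by presburger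
    have m: "k mod 2 = 0" "k mod 3 = 1" using 5(1) by presburger+
    have "odd (k - 5)" "\<not> 3 dvd k - 5" "\<not> 5 dvd k - 5"
      by (rule not_dvd_diff; use lower m 5(2) in simp)+
    then show ?thesis using lower by (intro exI[of _ 5] exI[of _ 19] exI[of _ 16]) auto
  next
    case 6
    have lower: "9 < k" using 6(1) ne(3,7) by presburger
    have m: "k mod 2 = 1" "k mod 3 = 0" using 6(1) by presburger+
    have "odd (k - 2)" "\<not> 3 dvd k - 2" "\<not> 5 dvd k - 2"
      by (rule not_dvd_diff; use lower m 6(2) in simp)+
    then show ?thesis using lower by (intro exI[of _ 2] exI[of _ 7] exI[of _ 7]) auto
  next
    case 7
    have lower: "26 < k" using 7 by presburger
    have m: "k mod 2 = 1" "k mod 3 = 0" using 7(1) by presburger+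
    have "odd (k - 4)" "\<not> 3 dvd k - 4" "\<not> 5 dvd k - 4"
      by (rule not_dvd_diff; use lower m 7(2) in simp)+
    then show ?thesis using lower by (intro exI[of _ 4] exI[of _ 17] exI[of _ 11]) auto
  qed
qed

lemma italian_set_exists_small:
  "italian_set_exists 3 4" "italian_set_exists 3 8" "italian_set_exists 3 9"
  using orthogonal_array_4 orthogonal_array_8 orthogonal_array_9
  by (auto intro!: orthogonal_array_imp_italian simp: numeral_eq_Suc)

text \<open>For odd \<open>k\<close> the base pair of order \<open>m\<close> is multiplied by a cyclic pair. For even \<open>k\<close> the order
\<open>k m\<close> is even, and from \<open>40\<close> on the blocks of orders \<open>3\<close>, \<open>4\<close> and \<open>5\<close> are used. What remains is
\<open>k = 4\<close>, again a product, and the orders \<open>30 = 6 \<cdot> 5\<close> and \<open>36 = 6 \<cdot> 6\<close>: there are no two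
orthogonal Latin squares of order \<open>6\<close>, so here the pair of order \<open>6\<close> is multiplied by an Italian
pair.\<close>

lemma non_latin_pair_exists:
  assumes k: "0 < k" "k \<noteq> 2" and m: "m \<in> {5, 6, 7, 11}"
  shows "non_latin_set_exists 2 (k * m)"
proof -
  have base: "non_latin_set_exists 2 5" "non_latin_set_exists 2 6" "non_latin_set_exists 2 7"
    "non_latin_set_exists 2 11"
    using non_latin_5 non_latin_6 non_latin_11 non_latin_set_exists_mono[OF _ non_latin_7, of 2] by auto
  have small: "italian_set_exists 2 0" "italian_set_exists 2 4" "italian_set_exists 2 8"
    using italian_set_exists_0 italian_set_exists_mono[OF _ italian_set_exists_small(1), of 2]
      italian_set_exists_mono[OF _ italian_set_exists_small(2), of 2] by auto
  have times: "non_latin_set_exists 2 (k * m)" if "italian_set_exists 2 k"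
  proof -
    have "non_latin_set_exists 2 m" using base m by blast
    from non_latin_set_exists_times[OF this that k(1)] show ?thesis by (simp add: mult.commute)
  qed
  consider "odd k" | "even k" "40 \<le> k * m" | "even k" "k * m < 40" by linarith
  then show ?thesis
  proof cases
    case 1
    then show ?thesis by (intro times italian_pair_odd)
  next
    case 2
    then have "even (k * m)" by simp
    then obtain g u1 u2 where *: "k * m = 3 * g + u1 + u2" "odd g" "\<not> 3 dvd g" "8 \<le> g"
      "u1 \<in> {5, 7}" "u2 \<in> {0, 4, 8}"
      using even_order_decomposition 2(2) by metis
    have "non_latin_set_exists 2 (3 * g + u1 + u2)"
      using * base small by (intro pair_from_base_3) auto
    then show ?thesis using *(1) by simp
  next
    case 3
    have "k < 8" using 3(2) m by auto
    then have "k = 4 \<or> k = 6" using 3(1) k by presburger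
    then consider "k = 4" | "k = 6" by metis
    then show ?thesis
    proof cases
      case 1
      then show ?thesis using small by (intro times) simp
    next
      case 2
      \<comment> \<open>For \<open>k = 6\<close> only the orders \<open>30\<close> and \<open>36\<close> are below \<open>40\<close>.\<close>
      have "non_latin_set_exists 2 (6 * 5)" "non_latin_set_exists 2 (6 * 6)"
        using non_latin_set_exists_times[OF base(2) non_latin_imp_italian[OF base(1)]]
          non_latin_set_exists_times[OF base(2) non_latin_imp_italian[OF base(2)]] by simp_all
      then show ?thesis using 2 3(2) m by auto
    qed
  qed
qed

text \<open>If \<open>k\<close> is prime to \<open>6\<close> or one of the small values \<open>4, 8, 9, 16\<close>, the triple of order \<open>7\<close> is
multiplied by a Latin one. Otherwise it is placed on the blocks that avoid the points at
infinity.\<close>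

lemma non_latin_triple_exists:
  assumes "0 < k" "k \<notin> {2, 3, 6, 10}"
  shows "non_latin_set_exists 3 (7 * k)"
proof -
  have times: "non_latin_set_exists 3 (7 * k)" if "italian_set_exists 3 k"
    using non_latin_set_exists_times[OF non_latin_7 that assms(1)] .
  have 16: "italian_set_exists 3 16"
    using italian_set_exists_times[OF italian_set_exists_small(1) italian_set_exists_small(1)] by simp
  consider "odd k" "\<not> 3 dvd k" | "k \<in> {4, 8, 9, 16}"
    | "even k \<or> 3 dvd k" "k \<notin> {0, 2, 3, 4, 6, 8, 9, 10, 16}" using assms by auto
  then show ?thesis
  proof cases
    case 1
    then show ?thesis by (intro times italian_triple_coprime_6)
  next
    case 2
    then show ?thesis using italian_set_exists_small 16 by (intro times) auto
  next
    case 3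
    obtain v u1 u2 where v: "v < k" "odd (k - v)" "\<not> 3 dvd (k - v)" "\<not> 5 dvd (k - v)" "7 * v = u1 + u2"
      "u1 < k - v" "u2 < k - v" and u: "(u1, u2) \<in> {(7, 0), (7, 7), (13, 8), (17, 11), (19, 16)}"
      using triple_order_decomposition[OF 3] by blast
    have "italian_set_exists 3 7" "italian_set_exists 3 13" "italian_set_exists 3 17"
      "italian_set_exists 3 11" "italian_set_exists 3 19"
      by (rule italian_triple_coprime_6; simp)+
    then have "italian_set_exists 3 u1" "italian_set_exists 3 u2"
      using u 16 italian_set_exists_small italian_set_exists_0 by auto
    then have "non_latin_set_exists 3 (7 * (k - v) + u1 + u2)"
      using v by (intro triple_from_base_7) auto
    also have "7 * (k - v) + u1 + u2 = 7 * k" using v by simp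
    finally show ?thesis .
  qed
qed

theorem theorem7p7:
  shows "(\<forall>k m :: nat. k > 0 \<and> k \<noteq> 2 \<and> m \<in> {5, 6, 7, 11} \<longrightarrow>
            (\<exists>A B. italian_square (k * m) A \<and> italian_square (k * m) B \<and>
                   orthogonal_squares (k * m) A B \<and>
                   \<not> latin_square (k * m) A \<and> \<not> latin_square (k * m) B)) \<and>
         (\<forall>k :: nat. k > 0 \<and> k \<notin> {2, 3, 6, 10} \<longrightarrow>
            (\<exists>S. card S = 3 \<and> pois (7 * k) S \<and> (\<forall>L\<in>S. \<not> latin_square (7 * k) L)))"
proof (intro conjI allI impI)
  fix k m :: nat assume "k > 0 \<and> k \<noteq> 2 \<and> m \<in> {5, 6, 7, 11}"
  then have "non_latin_set_exists 2 (k * m)" using non_latin_pair_exists by blast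
  then obtain L where "\<forall>c<2::nat. italian_square (k * m) (L c) \<and> \<not> latin_square (k * m) (L c)"
    "\<forall>c<2::nat. \<forall>d<2::nat. c \<noteq> d \<longrightarrow> orthogonal_squares (k * m) (L c) (L d)"
    using non_latin_squares by blast
  then show "\<exists>A B. italian_square (k * m) A \<and> italian_square (k * m) B \<and>
      orthogonal_squares (k * m) A B \<and> \<not> latin_square (k * m) A \<and> \<not> latin_square (k * m) B"
    by (intro exI[of _ "L 0"] exI[of _ "L 1"]) simp
next
  fix k :: nat assume k: "k > 0 \<and> k \<notin> {2, 3, 6, 10}"
  then have "non_latin_set_exists 3 (7 * k)" using non_latin_triple_exists by blast
  then obtain L where L: "\<forall>c<3::nat. italian_square (7 * k) (L c) \<and> \<not> latin_square (7 * k) (L c)"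
    "\<forall>c<3::nat. \<forall>d<3::nat. c \<noteq> d \<longrightarrow> orthogonal_squares (7 * k) (L c) (L d)"
    using non_latin_squares by blast
  have "inj_on L {..<3}"
  proof (rule inj_onI, rule ccontr)
    fix c d assume "c \<in> {..<3}" "d \<in> {..<3}" "L c = L d" "c \<noteq> d"
    then show False using orthogonal_imp_distinct[of "7 * k" "L c" "L d"] L k by auto
  qed
  then have "card (L ` {..<3}) = 3" by (simp add: card_image)
  moreover have "pois (7 * k) (L ` {..<3})"
    unfolding pois_def pairwise_def using L by auto
  ultimately show "\<exists>S. card S = 3 \<and> pois (7 * k) S \<and> (\<forall>L\<in>S. \<not> latin_square (7 * k) L)"
    using L(1) by (intro exI[of _ "L ` {..<3}"]) auto
qed

end
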